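(* Let $n\ge1$, let $(M,\omega)$ be an $n$-plectic manifold, $\mathfrak g$ a finite-dimensional real Lie algebra and $\zeta:\mathfrak g\to\mathfrak X(M,\omega)$ an infinitesimal $n$-plectic action, with associated classes $h_k\in H^k(\mathfrak g)\otimes H^{n+1-k}_{dR}(M)$. If $h_{n+1}=0$ and $h_n=0$, then there exists a multi-moment map for $\zeta$ (in the sense of Madsen and Swann).
   Context: An $n$-plectic manifold $(M,\omega)$ is a smooth manifold $M$ with a closed $(n+1)$-form $\omega$ such that $T_pM\to\Lambda^nT_p^*M$, $v\mapsto\iota_v\omega_p$, is injective for all $p\in M$. $\mathfrak X(M,\omega)=\{v\in\mathfrak X(M)\mid \mathcal L_v\omega=0\}$. An infinitesimal $n$-plectic action is a Lie algebra homomorphism $\zeta:\mathfrak g\to\mathfrak X(M)$ with image in $\mathfrak X(M,\omega)$. Chevalley-Eilenberg differential $\delta:\Lambda^k\mathfrak g^*\to\Lambda^{k+1}\mathfrak g^*$ (trivial representation): $$(\delta f)(X_1,\dots,X_{k+1})=\sum_{1\le i<j\le k+1}(-1)^{i+j}f([X_i,X_j],X_1,\dots,\hat X_i,\dots,\hat X_j,\dots,X_{k+1}),$$ with $\delta=0$ on $\Lambda^0\mathfrak g^*$; its cohomology is $H^\bullet(\mathfrak g)$. Its dual is $\delta^*:\Lambda^n\mathfrak g\to\Lambda^{n-1}\mathfrak g$. The classes $h_k$. For $1\le k\le n+1$ let $g_k\in\Lambda^k\mathfrak g^*\otimes\Omega^{n+1-k}(M)$ (identified with $k$-multilinear skew-symmetric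 maps $\mathfrak g^k\to\Omega^{n+1-k}(M)$) be $g_k(X_1,\dots,X_k)=-(-1)^{k(k+1)/2}\iota_{\zeta(X_k)}\cdots\iota_{\zeta(X_1)}\omega$. Let $q_\Lambda:\Lambda^k\mathfrak g^*\to\Lambda^k\mathfrak g^*/(\Lambda^k\mathfrak g^* )_{ex}$ and $q_\Omega:\Omega^l(M)\to\Omega^l(M)/\Omega^l_{ex}(M)$ be the quotient maps by the subspaces of $\delta$-exact, respectively $d$-exact, elements. Then $h_k:=(q_\Lambda\otimes q_\Omega)(g_k)$, which lies in the subspace $H^k(\mathfrak g)\otimes H^{n+1-k}_{dR}(M)$ of $\frac{\Lambda^k\mathfrak g^*}{(\Lambda^k\mathfrak g^* )_{ex}}\otimes\frac{\Omega^{n+1-k}(M)}{\Omega^{n+1-k}_{ex}(M)}$. Multi-moment map. Let $P_{\mathfrak g}=\ker(\delta^*:\Lambda^n\mathfrak g\to\Lambda^{n-1}\mathfrak g)$. A multi-moment map is a map $v:M\to P_{\mathfrak g}^*$, equivalently a linear map $\bar v:P_{\mathfrak g}\to C^\infty(M)$, satisfying (i) $d(\bar v(p))=\iota_{\zeta(p)}\omega$ for all $p\in P_{\mathfrak g}$, and (ii) $\bar v(\mathrm{ad}_X(p))=\mathcal L_{\zeta(X)}(\bar v(p))$ for all $X\in\mathfrak g$, $p\in P_{\mathfrak g}$. Here, for $p=\sum_\alpha X_1^\alpha\wedge\dots\wedge X_n^\alpha$, $\iota_{\zeta(p)}\omega=\sum_\alpha\iota_{\zeta(X_n^\alpha)}\cdots\iota_{\zeta(X_1^\alpha)}\omega$,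 and $\mathrm{ad}_X(p)$ is the natural (derivation) action $\mathrm{ad}_X(X_1\wedge\dots\wedge X_n)=\sum_iX_1\wedge\dots\wedge[X,X_i]\wedge\dots\wedge X_n$ extended linearly. *)

theory Defs
  imports "HOL-Analysis.Analysis" "HOL-Analysis.Finite_Function_Topology"
    "HOL-Library.Function_Algebras"
begin

section \<open>Function spaces as real vector spaces\<close>

text \<open>Tangent vectors, vector fields, differential forms and exterior forms are all functions into
  a real vector space; addition and zero are the pointwise ones of \<^theory>\<open>HOL-Library.Function_Algebras\<close>.\<close>

instantiation "fun" :: (type, real_vector) real_vector
begin

definition scaleR_fun :: "real \<Rightarrow> ('a \<Rightarrow> 'b) \<Rightarrow> 'a \<Rightarrow> 'b"
  where "scaleR_fun r f = (\<lambda>x. r *\<^sub>R f x)"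

instance
  by standard (simp_all add: scaleR_fun_def fun_eq_iff algebra_simps)

end

definition linear_on :: "'v::real_vector set \<Rightarrow> ('v \<Rightarrow> 'w::real_vector) \<Rightarrow> bool"
  where "linear_on V f \<longleftrightarrow>
    (\<forall>x\<in>V. \<forall>y\<in>V. f (x + y) = f x + f y) \<and> (\<forall>c. \<forall>x\<in>V. f (c *\<^sub>R x) = c *\<^sub>R f x)"

definition tuples :: "nat \<Rightarrow> 'v set \<Rightarrow> 'v list set"
  where "tuples k V = {xs. length xs = k \<and> set xs \<subseteq> V}"


section \<open>Quotients and tensor products of real vector spaces\<close>

definition residue_class :: "'v::real_vector set \<Rightarrow> 'v \<Rightarrow> 'v set"
  where "residue_class N x = {x + y | y. y \<in> N}"

text \<open>The free real vector space on a set of generators consists of the finitely supported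
  functions; \<open>formal_tensor A B\<close> is the generator belonging to the pair \<open>(A, B)\<close>.\<close>

definition formal_tensor :: "'x \<Rightarrow> 'y \<Rightarrow> ('x \<times> 'y \<Rightarrow>\<^sub>0 real)"
  where "formal_tensor A B = Poly_Mapping.single (A, B) 1"

text \<open>For subspaces \<open>N \<subseteq> V\<close> and \<open>K \<subseteq> W\<close>, the space \<open>(V/N) \<otimes> (W/K)\<close> is the free vector space on
  \<open>(V/N) \<times> (W/K)\<close> modulo the span of the bilinearity relations. The vector space operations of
  \<open>V/N\<close> and \<open>W/K\<close> enter through representatives. (Pairs of sets that are not residue classes are
  further generators, without relations; they are never used.)\<close>

definition tensor_relations ::
  "'v::real_vector set \<Rightarrow> 'v set \<Rightarrow> 'w::real_vector set \<Rightarrow> 'w set \<Rightarrow> ('v set \<times> 'w set \<Rightarrow>\<^sub>0 real) set"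
  where "tensor_relations V N W K =
    {formal_tensor (residue_class N (x + x')) (residue_class K y)
      - formal_tensor (residue_class N x) (residue_class K y)
      - formal_tensor (residue_class N x') (residue_class K y) | x x' y. x \<in> V \<and> x' \<in> V \<and> y \<in> W}
    \<union> {formal_tensor (residue_class N x) (residue_class K (y + y'))
      - formal_tensor (residue_class N x) (residue_class K y)
      - formal_tensor (residue_class N x) (residue_class K y') | x y y'. x \<in> V \<and> y \<in> W \<and> y' \<in> W}
    \<union> {formal_tensor (residue_class N (c *\<^sub>R x)) (residue_class K y)
      - c *\<^sub>R formal_tensor (residue_class N x) (residue_class K y) | c x y. x \<in> V \<and> y \<in> W}
    \<union> {formal_tensor (residue_class N x) (residue_class K (c *\<^sub>R y))
      - c *\<^sub>R formal_tensor (residue_class N x) (residue_class K y) | c x y. x \<in> V \<and> y \<in> W}"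

definition quotient_tensor ::
  "'v::real_vector set \<Rightarrow> 'v set \<Rightarrow> 'w::real_vector set \<Rightarrow> 'w set
    \<Rightarrow> ('v set \<times> 'w set \<Rightarrow>\<^sub>0 real) \<Rightarrow> ('v set \<times> 'w set \<Rightarrow>\<^sub>0 real) set"
  where "quotient_tensor V N W K z = residue_class (span (tensor_relations V N W K)) z"


section \<open>Smooth manifolds\<close>

text \<open>\<open>E\<close> is the linear subspace of the ambient Euclidean space on which the manifold is modelled,
  and \<open>S\<close> is meant to be open in \<open>E\<close>; only derivatives in directions of \<open>E\<close> are taken. Working with
  a subspace rather than a whole type admits manifolds of dimension \<open>0\<close>.\<close>

primrec Ck_on :: "nat \<Rightarrow> 'e::real_normed_vector set \<Rightarrow> 'e set \<Rightarrow> ('e \<Rightarrow> 'b::real_normed_vector) \<Rightarrow> bool"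
  where
    "Ck_on 0 E S f \<longleftrightarrow> continuous_on S f"
  | "Ck_on (Suc k) E S f \<longleftrightarrow> continuous_on S f \<and>
      (\<forall>v\<in>E. \<exists>g. (\<forall>x\<in>S. ((\<lambda>t. f (x + t *\<^sub>R v)) has_vector_derivative g x) (at 0)) \<and> Ck_on k E S g)"

definition smooth_on :: "'e::real_normed_vector set \<Rightarrow> 'e set \<Rightarrow> ('e \<Rightarrow> 'b::real_normed_vector) \<Rightarrow> bool"
  where "smooth_on E S f \<longleftrightarrow> (\<forall>k. Ck_on k E S f)"

text \<open>A smooth structure: the model space together with an atlas (not necessarily maximal), a chart
  being a pair of its domain and the coordinate map. The points are those of the type \<open>'a\<close>.\<close>

type_synonym ('a, 'e) smooth_structure = "'e set \<times> ('a set \<times> ('a \<Rightarrow> 'e)) set"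

definition smooth_manifold ::
  "('a::{t2_space, second_countable_topology}, 'e::euclidean_space) smooth_structure \<Rightarrow> bool"
  where "smooth_manifold M \<longleftrightarrow> (case M of (E, A) \<Rightarrow>
    subspace E \<and> (\<Union>(U, \<phi>)\<in>A. U) = UNIV \<and>
    (\<forall>(U, \<phi>)\<in>A. open U \<and> openin (top_of_set E) (\<phi> ` U) \<and>
      homeomorphism U (\<phi> ` U) \<phi> (inv_into U \<phi>)) \<and>
    (\<forall>(U, \<phi>)\<in>A. \<forall>(V, \<psi>)\<in>A. smooth_on E (\<phi> ` (U \<inter> V)) (\<psi> \<circ> inv_into U \<phi>)))"

definition smooth_functions ::
  "('a::{t2_space, second_countable_topology}, 'e::euclidean_space) smooth_structure \<Rightarrow> ('a \<Rightarrow> real) set"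
  where "smooth_functions M = (case M of (E, A) \<Rightarrow>
    {f. \<forall>(U, \<phi>)\<in>A. smooth_on E (\<phi> ` U) (f \<circ> inv_into U \<phi>)})"

text \<open>Tangent vectors are derivations of the algebra of smooth functions at a point, made
  extensional by the value \<open>0\<close> on non-smooth functions.\<close>

type_synonym 'a tangent_vector = "('a \<Rightarrow> real) \<Rightarrow> real"

definition tangent_space ::
  "('a::{t2_space, second_countable_topology}, 'e::euclidean_space) smooth_structure
    \<Rightarrow> 'a \<Rightarrow> 'a tangent_vector set"
  where "tangent_space M p =
    {v. linear_on (smooth_functions M) v \<and> (\<forall>f. f \<notin> smooth_functions M \<longrightarrow> v f = 0) \<and>
      (\<forall>f\<in>smooth_functions M. \<forall>g\<in>smooth_functions M. v (\<lambda>x. f x * g x) = f p * v g + g p * v f)}"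

type_synonym 'a vector_field = "'a \<Rightarrow> 'a tangent_vector"

definition apply_field :: "'a vector_field \<Rightarrow> ('a \<Rightarrow> real) \<Rightarrow> 'a \<Rightarrow> real"
  where "apply_field X f = (\<lambda>p. X p f)"

definition vector_fields ::
  "('a::{t2_space, second_countable_topology}, 'e::euclidean_space) smooth_structure
    \<Rightarrow> 'a vector_field set"
  where "vector_fields M =
    {X. (\<forall>p. X p \<in> tangent_space M p) \<and>
      (\<forall>f\<in>smooth_functions M. apply_field X f \<in> smooth_functions M)}"

definition times_field :: "('a \<Rightarrow> real) \<Rightarrow> 'a vector_field \<Rightarrow> 'a vector_field"
  where "times_field f X = (\<lambda>p. f p *\<^sub>R X p)"

text \<open>The guard only serves extensionality of the tangent vector.\<close>

definition field_bracket ::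
  "('a::{t2_space, second_countable_topology}, 'e::euclidean_space) smooth_structure
    \<Rightarrow> 'a vector_field \<Rightarrow> 'a vector_field \<Rightarrow> 'a vector_field"
  where "field_bracket M X Y = (\<lambda>p f. if f \<in> smooth_functions M
    then X p (apply_field Y f) - Y p (apply_field X f) else 0)"


section \<open>Differential forms\<close>

text \<open>A \<open>k\<close>-form is an alternating \<open>C\<^sup>\<infinity>(M)\<close>-multilinear map from \<open>k\<close>-tuples (lists of length \<open>k\<close>)
  of vector fields to \<open>C\<^sup>\<infinity>(M)\<close>, with value \<open>0\<close> off these tuples. In particular a \<open>0\<close>-form is
  determined by its value on the empty list, a smooth function.\<close>

type_synonym 'a form = "'a vector_field list \<Rightarrow> 'a \<Rightarrow> real"

definition forms ::
  "('a::{t2_space, second_countable_topology}, 'e::euclidean_space) smooth_structure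
    \<Rightarrow> nat \<Rightarrow> 'a form set"
  where "forms M k = {\<alpha>.
    (\<forall>Xs\<in>tuples k (vector_fields M). \<alpha> Xs \<in> smooth_functions M) \<and>
    (\<forall>Xs. Xs \<notin> tuples k (vector_fields M) \<longrightarrow> \<alpha> Xs = 0) \<and>
    (\<forall>Xs\<in>tuples k (vector_fields M). \<forall>i<k. \<forall>X\<in>vector_fields M. \<forall>Y\<in>vector_fields M.
      \<alpha> (Xs[i := X + Y]) = \<alpha> (Xs[i := X]) + \<alpha> (Xs[i := Y])) \<and>
    (\<forall>Xs\<in>tuples k (vector_fields M). \<forall>i<k. \<forall>f\<in>smooth_functions M. \<forall>X\<in>vector_fields M.
      \<alpha> (Xs[i := times_field f X]) = (\<lambda>p. f p * \<alpha> (Xs[i := X]) p)) \<and>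
    (\<forall>Xs\<in>tuples k (vector_fields M). \<forall>i<k. \<forall>j<k. i \<noteq> j \<and> Xs ! i = Xs ! j \<longrightarrow> \<alpha> Xs = 0)}"

definition zero_form :: "('a \<Rightarrow> real) \<Rightarrow> 'a form"
  where "zero_form f = (\<lambda>Xs. if Xs = [] then f else 0)"

text \<open>The value of a form on tangent vectors at a point, obtained by extending these to vector
  fields; by \<open>C\<^sup>\<infinity>(M)\<close>-linearity it does not depend on the extensions.\<close>

definition extend_tangent ::
  "('a::{t2_space, second_countable_topology}, 'e::euclidean_space) smooth_structure
    \<Rightarrow> 'a \<Rightarrow> 'a tangent_vector \<Rightarrow> 'a vector_field"
  where "extend_tangent M p v = (SOME X. X \<in> vector_fields M \<and> X p = v)"

definition form_at ::
  "('a::{t2_space, second_countable_topology}, 'e::euclidean_space) smooth_structure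
    \<Rightarrow> 'a form \<Rightarrow> 'a \<Rightarrow> 'a tangent_vector list \<Rightarrow> real"
  where "form_at M \<alpha> p vs = \<alpha> (map (extend_tangent M p) vs) p"

definition contract :: "'a vector_field \<Rightarrow> 'a form \<Rightarrow> 'a form"
  where "contract X \<alpha> = (\<lambda>Xs. \<alpha> (X # Xs))"

text \<open>With arguments numbered from \<open>0\<close>:
  \<open>(d\<alpha>)(X\<^sub>0,\<dots>,X\<^sub>k)\<close> is the sum of \<open>(-1)\<^sup>i X\<^sub>i(\<alpha>(\<dots>))\<close> with \<open>X\<^sub>i\<close> omitted from the arguments, over
  all \<open>i\<close>, and of \<open>(-1)\<^sup>i\<^sup>+\<^sup>j \<alpha>([X\<^sub>i,X\<^sub>j],\<dots>)\<close> with \<open>X\<^sub>i\<close> and \<open>X\<^sub>j\<close> omitted, over all \<open>i < j\<close>. The degree is not a parameter since a \<open>k\<close>-form vanishes off \<open>k\<close>-tuples.\<close>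

definition ext_deriv ::
  "('a::{t2_space, second_countable_topology}, 'e::euclidean_space) smooth_structure
    \<Rightarrow> 'a form \<Rightarrow> 'a form"
  where "ext_deriv M \<alpha> = (\<lambda>Xs. if set Xs \<subseteq> vector_fields M then
      (\<Sum>i<length Xs. (-1) ^ i *\<^sub>R apply_field (Xs ! i) (\<alpha> (nths Xs (- {i})))) +
      (\<Sum>j<length Xs. \<Sum>i<j. (-1) ^ (i + j) *\<^sub>R
        \<alpha> (field_bracket M (Xs ! i) (Xs ! j) # nths Xs (- {i, j})))
    else 0)"

definition lie_deriv ::
  "('a::{t2_space, second_countable_topology}, 'e::euclidean_space) smooth_structure
    \<Rightarrow> 'a vector_field \<Rightarrow> 'a form \<Rightarrow> 'a form"
  where "lie_deriv M V \<alpha> = (\<lambda>Xs. if set Xs \<subseteq> vector_fields M then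
      apply_field V (\<alpha> Xs) - (\<Sum>i<length Xs. \<alpha> (Xs[i := field_bracket M V (Xs ! i)]))
    else 0)"

definition exact_forms ::
  "('a::{t2_space, second_countable_topology}, 'e::euclidean_space) smooth_structure
    \<Rightarrow> nat \<Rightarrow> 'a form set"
  where "exact_forms M k = (case k of 0 \<Rightarrow> {0} | Suc l \<Rightarrow> ext_deriv M ` forms M l)"


section \<open>Lie algebras and their cohomology\<close>

definition lie_algebra :: "('g::real_vector \<Rightarrow> 'g \<Rightarrow> 'g) \<Rightarrow> bool"
  where "lie_algebra br \<longleftrightarrow> bilinear br \<and> (\<forall>X. br X X = 0) \<and>
    (\<forall>X Y Z. br X (br Y Z) + br Y (br Z X) + br Z (br X Y) = 0)"

definition multilinear_alternating :: "nat \<Rightarrow> ('g::real_vector list \<Rightarrow> 'w::real_vector) set"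
  where "multilinear_alternating k = {f.
    (\<forall>Xs. length Xs \<noteq> k \<longrightarrow> f Xs = 0) \<and>
    (\<forall>Xs. length Xs = k \<longrightarrow> (\<forall>i<k. linear (\<lambda>X. f (Xs[i := X])))) \<and>
    (\<forall>Xs. length Xs = k \<longrightarrow> (\<forall>i<k. \<forall>j<k. i \<noteq> j \<and> Xs ! i = Xs ! j \<longrightarrow> f Xs = 0))}"

text \<open>\<open>\<Lambda>\<^sup>k \<gg>\<^sup>*\<close>, as the space of alternating \<open>k\<close>-linear functions on \<open>\<gg>\<close>.\<close>

definition ext_forms :: "nat \<Rightarrow> ('g::real_vector list \<Rightarrow> real) set"
  where "ext_forms k = multilinear_alternating k"

definition ce_diff :: "('g::real_vector \<Rightarrow> 'g \<Rightarrow> 'g) \<Rightarrow> ('g list \<Rightarrow> real) \<Rightarrow> 'g list \<Rightarrow> real"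
  where "ce_diff br f = (\<lambda>Xs. \<Sum>j<length Xs. \<Sum>i<j.
    (-1) ^ (i + j) * f (br (Xs ! i) (Xs ! j) # nths Xs (- {i, j})))"

definition exact_ext_forms ::
  "('g::real_vector \<Rightarrow> 'g \<Rightarrow> 'g) \<Rightarrow> nat \<Rightarrow> ('g list \<Rightarrow> real) set"
  where "exact_ext_forms br k = (case k of 0 \<Rightarrow> {0} | Suc l \<Rightarrow> ce_diff br ` ext_forms l)"

text \<open>\<open>\<Lambda>\<^sup>n \<gg>\<close> for finite-dimensional \<open>\<gg>\<close>: the element \<open>X\<^sub>1 \<and> \<dots> \<and> X\<^sub>n\<close> is represented by the functional
  \<open>f \<mapsto> f(X\<^sub>1,\<dots>,X\<^sub>n)\<close> on \<open>\<Lambda>\<^sup>n \<gg>\<^sup>*\<close>.\<close>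

type_synonym 'g multivector = "('g list \<Rightarrow> real) \<Rightarrow> real"

definition wedge :: "'g::real_vector list \<Rightarrow> 'g multivector"
  where "wedge Xs = (\<lambda>f. if f \<in> ext_forms (length Xs) then f Xs else 0)"

definition ext_power :: "nat \<Rightarrow> 'g::real_vector multivector set"
  where "ext_power n = span (wedge ` tuples n UNIV)"

text \<open>The dual \<open>\<delta>\<^sup>* : \<Lambda>\<^sup>n \<gg> \<rightarrow> \<Lambda>\<^sup>n\<^sup>-\<^sup>1 \<gg>\<close> of \<open>\<delta> : \<Lambda>\<^sup>n\<^sup>-\<^sup>1 \<gg>\<^sup>* \<rightarrow> \<Lambda>\<^sup>n \<gg>\<^sup>*\<close>.\<close>

definition ce_codiff ::
  "('g::real_vector \<Rightarrow> 'g \<Rightarrow> 'g) \<Rightarrow> nat \<Rightarrow> 'g multivector \<Rightarrow> 'g multivector"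
  where "ce_codiff br n p = (\<lambda>f. if f \<in> ext_forms (n - 1) then p (ce_diff br f) else 0)"

definition lie_kernel ::
  "('g::real_vector \<Rightarrow> 'g \<Rightarrow> 'g) \<Rightarrow> nat \<Rightarrow> 'g multivector set"
  where "lie_kernel br n = {p \<in> ext_power n. ce_codiff br n p = 0}"

text \<open>A presentation \<open>p = \<Sum>\<^sub>\<alpha> X\<^sub>1\<^sup>\<alpha> \<and> \<dots> \<and> X\<^sub>n\<^sup>\<alpha>\<close> (\<open>n \<ge> 1\<close>). The linear extensions defined from it below
  do not depend on the chosen presentation.\<close>

definition wedge_terms :: "nat \<Rightarrow> 'g::real_vector multivector \<Rightarrow> 'g list list"
  where "wedge_terms n p = (SOME ts. set ts \<subseteq> tuples n UNIV \<and> p = (\<Sum>Xs\<leftarrow>ts. wedge Xs))"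

definition ad_action ::
  "('g::real_vector \<Rightarrow> 'g \<Rightarrow> 'g) \<Rightarrow> nat \<Rightarrow> 'g \<Rightarrow> 'g multivector \<Rightarrow> 'g multivector"
  where "ad_action br n X p =
    (\<Sum>Xs\<leftarrow>wedge_terms n p. \<Sum>i<n. wedge (Xs[i := br X (Xs ! i)]))"


section \<open>\<open>n\<close>-plectic actions, the classes \<open>h\<^sub>k\<close> and multi-moment maps\<close>

definition n_plectic_manifold ::
  "('a::{t2_space, second_countable_topology}, 'e::euclidean_space) smooth_structure
    \<Rightarrow> nat \<Rightarrow> 'a form \<Rightarrow> bool"
  where "n_plectic_manifold M n \<omega> \<longleftrightarrow>
    smooth_manifold M \<and> \<omega> \<in> forms M (n + 1) \<and> ext_deriv M \<omega> = 0 \<and>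
    (\<forall>p. inj_on (\<lambda>v vs. if vs \<in> tuples n (tangent_space M p) then form_at M \<omega> p (v # vs) else 0)
      (tangent_space M p))"

definition preserving_fields ::
  "('a::{t2_space, second_countable_topology}, 'e::euclidean_space) smooth_structure
    \<Rightarrow> 'a form \<Rightarrow> 'a vector_field set"
  where "preserving_fields M \<omega> = {V \<in> vector_fields M. lie_deriv M V \<omega> = 0}"

definition n_plectic_action ::
  "('a::{t2_space, second_countable_topology}, 'e::euclidean_space) smooth_structure
    \<Rightarrow> 'a form \<Rightarrow> ('g::real_vector \<Rightarrow> 'g \<Rightarrow> 'g) \<Rightarrow> ('g \<Rightarrow> 'a vector_field) \<Rightarrow> bool"
  where "n_plectic_action M \<omega> br \<zeta> \<longleftrightarrow>
    linear \<zeta> \<and> (\<forall>X Y. \<zeta> (br X Y) = field_bracket M (\<zeta> X) (\<zeta> Y)) \<and> range \<zeta> \<subseteq> preserving_fields M \<omega>"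

text \<open>\<open>\<iota>\<^bsub>\<zeta>(X\<^sub>k)\<^esub> \<cdots> \<iota>\<^bsub>\<zeta>(X\<^sub>1)\<^esub> \<omega>\<close>\<close>

definition contract_tuple ::
  "('g \<Rightarrow> 'a vector_field) \<Rightarrow> 'g list \<Rightarrow> 'a form \<Rightarrow> 'a form"
  where "contract_tuple \<zeta> Xs \<omega> = fold (\<lambda>X. contract (\<zeta> X)) Xs \<omega>"

definition contract_multivector ::
  "nat \<Rightarrow> ('g::real_vector \<Rightarrow> 'a vector_field) \<Rightarrow> 'g multivector \<Rightarrow> 'a form \<Rightarrow> 'a form"
  where "contract_multivector n \<zeta> p \<omega> = (\<Sum>Xs\<leftarrow>wedge_terms n p. contract_tuple \<zeta> Xs \<omega>)"

definition g_cochain :: "'a form \<Rightarrow> ('g \<Rightarrow> 'a vector_field) \<Rightarrow> nat \<Rightarrow> 'g list \<Rightarrow> 'a form"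
  where "g_cochain \<omega> \<zeta> k = (\<lambda>Xs. if length Xs = k
    then - ((-1) ^ (k * (k + 1) div 2)) *\<^sub>R contract_tuple \<zeta> Xs \<omega> else 0)"

text \<open>Under the identification of \<open>\<Lambda>\<^sup>k \<gg>\<^sup>* \<otimes> \<Omega>\<^sup>l(M)\<close> with the alternating \<open>k\<close>-linear maps from \<open>\<gg>\<close> to
  \<open>\<Omega>\<^sup>l(M)\<close>, a map \<open>g\<close> corresponds to a tensor \<open>\<Sum>\<^sub>i f\<^sub>i \<otimes> \<alpha>\<^sub>i\<close>, here the list of pairs \<open>(f\<^sub>i, \<alpha>\<^sub>i)\<close>; for
  finite-dimensional \<open>\<gg>\<close> the presentation exists and is unique as a tensor.\<close>

definition tensor_terms ::
  "('a::{t2_space, second_countable_topology}, 'e::euclidean_space) smooth_structure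
    \<Rightarrow> nat \<Rightarrow> nat \<Rightarrow> ('g::real_vector list \<Rightarrow> 'a form) \<Rightarrow> (('g list \<Rightarrow> real) \<times> 'a form) list"
  where "tensor_terms M k l g = (SOME ts. set ts \<subseteq> ext_forms k \<times> forms M l \<and>
    g = (\<lambda>Xs. \<Sum>(f, \<alpha>)\<leftarrow>ts. f Xs *\<^sub>R \<alpha>))"

text \<open>The target \<open>\<Lambda>\<^sup>k\<gg>\<^sup>*/(\<Lambda>\<^sup>k\<gg>\<^sup>*)\<^sub>e\<^sub>x \<otimes> \<Omega>\<^sup>l(M)/\<Omega>\<^sup>l\<^sub>e\<^sub>x(M)\<close> of \<open>q\<^sub>\<Lambda> \<otimes> q\<^sub>\<Omega>\<close>:
  \<open>mixed_class M br k l z\<close> is the element represented by the formal combination \<open>z\<close>.\<close>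

definition mixed_class ::
  "('a::{t2_space, second_countable_topology}, 'e::euclidean_space) smooth_structure
    \<Rightarrow> ('g::real_vector \<Rightarrow> 'g \<Rightarrow> 'g) \<Rightarrow> nat \<Rightarrow> nat
    \<Rightarrow> (('g list \<Rightarrow> real) set \<times> 'a form set \<Rightarrow>\<^sub>0 real)
    \<Rightarrow> (('g list \<Rightarrow> real) set \<times> 'a form set \<Rightarrow>\<^sub>0 real) set"
  where "mixed_class M br k l =
    quotient_tensor (ext_forms k) (exact_ext_forms br k) (forms M l) (exact_forms M l)"

definition h_class ::
  "('a::{t2_space, second_countable_topology}, 'e::euclidean_space) smooth_structure
    \<Rightarrow> nat \<Rightarrow> 'a form \<Rightarrow> ('g::real_vector \<Rightarrow> 'g \<Rightarrow> 'g) \<Rightarrow> ('g \<Rightarrow> 'a vector_field) \<Rightarrow> nat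
    \<Rightarrow> (('g list \<Rightarrow> real) set \<times> 'a form set \<Rightarrow>\<^sub>0 real) set"
  where "h_class M n \<omega> br \<zeta> k = mixed_class M br k (n + 1 - k)
    (\<Sum>(f, \<alpha>)\<leftarrow>tensor_terms M k (n + 1 - k) (g_cochain \<omega> \<zeta> k).
      formal_tensor (residue_class (exact_ext_forms br k) f)
        (residue_class (exact_forms M (n + 1 - k)) \<alpha>))"

definition multi_moment_map ::
  "('a::{t2_space, second_countable_topology}, 'e::euclidean_space) smooth_structure
    \<Rightarrow> nat \<Rightarrow> 'a form \<Rightarrow> ('g::real_vector \<Rightarrow> 'g \<Rightarrow> 'g) \<Rightarrow> ('g \<Rightarrow> 'a vector_field)
    \<Rightarrow> ('g multivector \<Rightarrow> 'a \<Rightarrow> real) \<Rightarrow> bool"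
  where "multi_moment_map M n \<omega> br \<zeta> v \<longleftrightarrow>
    linear_on (lie_kernel br n) v \<and> v ` lie_kernel br n \<subseteq> smooth_functions M \<and>
    (\<forall>p\<in>lie_kernel br n. ext_deriv M (zero_form (v p)) = contract_multivector n \<zeta> p \<omega>) \<and>
    (\<forall>X. \<forall>p\<in>lie_kernel br n.
      zero_form (v (ad_action br n X p)) = lie_deriv M (\<zeta> X) (zero_form (v p)))"

end

theory Submission
  imports Defs
begin

text \<open>Let \<open>P = lie_kernel br n\<close>, the space of \<open>n\<close>-vectors on which all exact \<open>n\<close>-forms \<open>\<delta>f\<close> of \<open>\<gg>\<close> vanish,
  and write \<open>\<iota>\<^sub>p\<omega>\<close> for the contraction of \<open>\<omega>\<close> with \<open>\<zeta>(p)\<close>.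

  The vanishing of a class \<open>h\<^sub>k\<close> says that the map \<open>(X\<^sub>1,\<dots>,X\<^sub>k) \<mapsto> \<iota>\<^bsub>\<zeta>(X\<^sub>k)\<^esub> \<cdots> \<iota>\<^bsub>\<zeta>(X\<^sub>1)\<^esub> \<omega>\<close> is a sum of products
  of a \<open>\<delta>\<close>-exact form on \<open>\<gg>\<close> with a form on \<open>M\<close>, and of products of a form on \<open>\<gg>\<close> with a \<open>d\<close>-exact form
  (\<open>h_class_zeroD\<close>; behind it is the description of the kernel of \<open>V \<otimes> W \<rightarrow> V/N \<otimes> W/K\<close> in
  \<open>quotient_tensor_eq_zeroD\<close>). This is used twice.

  For \<open>k = n\<close>, evaluate on \<open>P\<close>: products of the first kind disappear, so \<open>p \<mapsto> \<iota>\<^sub>p\<omega>\<close> takes exact values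
  and has a linear primitive \<open>v\<^sub>0\<close> on \<open>P\<close> (\<open>primitive_on_lie_kernel\<close>). Such a primitive need not be
  equivariant.

  For \<open>k = n + 1\<close>, the only exact \<open>0\<close>-form on \<open>M\<close> is zero, so the map is a sum of products
  \<open>\<delta>f \<cdot> a\<close> with \<open>f \<in> \<Lambda>\<^sup>n\<gg>\<^sup>*\<close> and \<open>a\<close> a function. Cartan's formula \<open>\<iota>\<^sub>X\<delta>f = - f \<circ> ad\<^sub>X - \<delta>\<iota>\<^sub>Xf\<close> (\<open>ce_diff_Cons\<close>)
  shows that on \<open>X \<and> p\<close> with \<open>p \<in> P\<close> it depends only on \<open>ad\<^sub>X p\<close>. The value is, up to sign,
  \<open>\<iota>\<^bsub>\<zeta>(X)\<^esub>\<iota>\<^sub>p\<omega> = \<zeta>(X)(v\<^sub>0(p))\<close>; hence \<open>\<zeta>(X)(v\<^sub>0(p)) = w(ad\<^sub>X p)\<close> for a linear \<open>w\<close>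
  (\<open>potential_on_ad_terms\<close>), and equivariance asks precisely for \<open>v = w\<close> on the span \<open>Q\<close> of all \<open>ad\<^sub>X p\<close>.
  This is compatible with being a primitive: \<open>\<zeta>(X)\<close> preserves \<open>\<omega>\<close>, so differentiating
  \<open>\<zeta>(X)(v\<^sub>0(p))\<close> gives the contraction of \<open>\<omega>\<close> with \<open>\<zeta>(ad\<^sub>X p)\<close> (\<open>derivative_along_preserving_action\<close>), which
  is also the differential of \<open>v\<^sub>0(ad\<^sub>X p)\<close>. Thus \<open>w - v\<^sub>0\<close> has differential zero on \<open>Q\<close>, and
  \<open>v = v\<^sub>0 + (w - v\<^sub>0) \<circ> \<pi>\<close> with a linear projection \<open>\<pi>\<close> onto \<open>Q\<close> is a multi-moment map.\<close>

section \<open>Sums in vector spaces of functions\<close>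

lemma sum_list_apply: "(\<Sum>x\<leftarrow>xs. F x) y = (\<Sum>x\<leftarrow>xs. F x y)"
  by (induction xs) simp_all

lemma sum_apply: "(\<Sum>x\<in>A. F x) y = (\<Sum>x\<in>A. F x y)"
  by (induction A rule: infinite_finite_induct) simp_all

lemma scaleR_sum_list: "(\<Sum>x\<leftarrow>xs. c *\<^sub>R F x) = c *\<^sub>R (\<Sum>x\<leftarrow>xs. F x)"
  for F :: "'x \<Rightarrow> 'v::real_vector"
  by (induction xs) (simp_all add: scaleR_add_right)

lemma sum_list_scaleR_left: "(\<Sum>x\<leftarrow>xs. c x *\<^sub>R v) = (\<Sum>x\<leftarrow>xs. c x) *\<^sub>R v"
  for v :: "'v::real_vector"
  by (induction xs) (simp_all add: scaleR_add_left)

lemma subspace_sum_list: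
  "subspace S \<Longrightarrow> (\<And>x. x \<in> set xs \<Longrightarrow> F x \<in> S) \<Longrightarrow> (\<Sum>x\<leftarrow>xs. F x) \<in> S"
  by (induction xs) (simp_all add: subspace_0 subspace_add)

lemma scaleR_fun_apply [simp]: "(c *\<^sub>R f) x = c *\<^sub>R f x"
  by (simp add: scaleR_fun_def)

section \<open>Alternating multilinear maps\<close>

text \<open>The counterpart of \<open>contract\<close> on cochains with arbitrary values. Most facts below are proved by
  induction on the degree or on the argument list, using that a cochain is determined by its
  contractions with all \<open>X\<close>.\<close>

definition contract_first :: "'g \<Rightarrow> ('g list \<Rightarrow> 'w) \<Rightarrow> 'g list \<Rightarrow> 'w"
  where "contract_first X f = (\<lambda>Xs. f (X # Xs))"

lemma multilinear_alternatingI: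
  assumes "\<And>Xs. length Xs \<noteq> k \<Longrightarrow> f Xs = 0"
    and "\<And>Xs i. i < length Xs \<Longrightarrow> linear (\<lambda>X. f (Xs[i := X]))"
    and "\<And>Xs i j. i < length Xs \<Longrightarrow> j < length Xs \<Longrightarrow> i \<noteq> j \<Longrightarrow> Xs ! i = Xs ! j \<Longrightarrow> f Xs = 0"
  shows "f \<in> multilinear_alternating k"
  unfolding multilinear_alternating_def
proof (intro CollectI conjI allI impI)
  fix Xs :: "'a list" and i j
  assume "length Xs = k" "i < k" "j < k" "i \<noteq> j \<and> Xs ! i = Xs ! j"
  then show "f Xs = 0" using assms(3)[of i Xs j] by simp
qed (use assms(1,2) in simp_all)

lemma multilinear_alternating_off:
  "f \<in> multilinear_alternating k \<Longrightarrow> length Xs \<noteq> k \<Longrightarrow> f Xs = 0"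
  by (simp add: multilinear_alternating_def)

lemma multilinear_alternating_linear:
  assumes "f \<in> multilinear_alternating k" "i < length Xs"
  shows "linear (\<lambda>X. f (Xs[i := X]))"
proof (cases "length Xs = k")
  case True
  then show ?thesis using assms by (simp add: multilinear_alternating_def)
next
  case False
  then have "(\<lambda>X. f (Xs[i := X])) = (\<lambda>_. 0)"
    using assms by (simp add: multilinear_alternating_off)
  then show ?thesis by (simp only: module_hom_zero)
qed

lemma multilinear_alternating_linear_Cons:
  "f \<in> multilinear_alternating k \<Longrightarrow> linear (\<lambda>X. f (X # Xs))"
  using multilinear_alternating_linear[of f k 0 "undefined # Xs"] by simp

lemma multilinear_alternating_equal:
  assumes "f \<in> multilinear_alternating k" "i < length Xs" "j < length Xs" "i \<noteq> j" "Xs ! i = Xs ! j"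
  shows "f Xs = 0"
  using assms by (cases "length Xs = k") (auto simp: multilinear_alternating_def)

lemma subspace_multilinear_alternating: "subspace (multilinear_alternating k)"
  unfolding subspace_def
proof (intro conjI ballI allI)
  show "0 \<in> multilinear_alternating k"
    by (simp add: multilinear_alternating_def module_hom_zero)
next
  fix f g :: "'a list \<Rightarrow> 'b" assume "f \<in> multilinear_alternating k" "g \<in> multilinear_alternating k"
  then show "f + g \<in> multilinear_alternating k"
    by (auto simp: multilinear_alternating_def intro!: linear_compose_add)
next
  fix f :: "'a list \<Rightarrow> 'b" and c assume "f \<in> multilinear_alternating k"
  then show "c *\<^sub>R f \<in> multilinear_alternating k"
    by (auto simp: multilinear_alternating_def intro!: linear_compose_scale_right)
qed

lemma contract_first_multilinear_alternating:
  assumes f: "f \<in> multilinear_alternating k"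
  shows "contract_first X f \<in> multilinear_alternating (k - 1)"
proof -
  have "contract_first X f Xs = 0" if "length Xs \<noteq> k - 1" for Xs
    using that multilinear_alternating_off[OF f, of "X # Xs"] by (auto simp: contract_first_def)
  moreover have "linear (\<lambda>Y. contract_first X f (Xs[i := Y]))" if "i < length Xs" for Xs i
    using that multilinear_alternating_linear[OF f, of "Suc i" "X # Xs"] by (simp add: contract_first_def)
  moreover have "contract_first X f Xs = 0" if "i < length Xs" "j < length Xs" "i \<noteq> j" "Xs ! i = Xs ! j"
    for Xs i j
    using that multilinear_alternating_equal[OF f, of "Suc i" "X # Xs" "Suc j"]
    by (simp add: contract_first_def)
  ultimately show ?thesis
    by (rule multilinear_alternatingI)
qed

text \<open>Polarization of \<open>f (X + Y, X + Y, \<dots>) = 0\<close>.\<close>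

lemma swap_first_two:
  assumes f: "f \<in> multilinear_alternating k"
  shows "f (X # Y # Xs) = - f (Y # X # Xs)"
proof -
  have l1: "linear (\<lambda>Z. f (Z # U # Xs))" and l2: "linear (\<lambda>Z. f (U # Z # Xs))" for U
    using multilinear_alternating_linear[OF f, of 0 "U # U # Xs"]
      multilinear_alternating_linear[OF f, of 1 "U # U # Xs"] by simp_all
  have eq: "f (U # U # Xs) = 0" for U
    using multilinear_alternating_equal[OF f, of 0 "U # U # Xs" 1] by simp
  have "0 = f ((X + Y) # (X + Y) # Xs)"
    by (simp add: eq)
  also have "\<dots> = f (X # Y # Xs) + f (Y # X # Xs)"
    by (simp add: linear_add[OF l1] linear_add[OF l2] eq[of X] eq[of Y])
  finally show ?thesis
    by (metis eq_neg_iff_add_eq_0)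
qed

text \<open>Bringing the entry in position \<open>m\<close> to the front takes \<open>m\<close> adjacent transpositions. The list on
  the left has the shape that occurs in the Chevalley-Eilenberg differential.\<close>

lemma move_to_front:
  assumes "f \<in> multilinear_alternating k" "m < length Xs"
  shows "f (Y # nths Xs (- {m})) = (-1) ^ m *\<^sub>R f (Xs[m := Y])"
  using assms
proof (induction m arbitrary: f k Xs)
  case 0
  then obtain Z Zs where "Xs = Z # Zs" by (cases Xs) auto
  moreover have "{j. Suc j \<in> - {0}} = UNIV" by auto
  ultimately show ?case by (simp add: nths_Cons nths_all)
next
  case (Suc m)
  then obtain Z Zs where Xs: "Xs = Z # Zs" by (cases Xs) auto
  have set: "{j. j \<noteq> m} = - {m}" by auto
  have "f (Y # nths Xs (- {Suc m})) = f (Y # Z # nths Zs (- {m}))"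
    by (simp add: Xs nths_Cons set)
  also have "\<dots> = - contract_first Z f (Y # nths Zs (- {m}))"
    unfolding contract_first_def by (rule swap_first_two[OF Suc.prems(1)])
  also have "\<dots> = - ((-1) ^ m *\<^sub>R contract_first Z f (Zs[m := Y]))"
    using Suc.IH[OF contract_first_multilinear_alternating[OF Suc.prems(1)], of Zs] Suc.prems(2) Xs
    by simp
  finally show ?case by (simp add: Xs contract_first_def)
qed

lemma move_last_to_front:
  assumes "f \<in> multilinear_alternating k"
  shows "f (Xs @ [X]) = (-1) ^ length Xs *\<^sub>R f (X # Xs)"
proof -
  have "nths (Xs @ [X]) (- {length Xs}) = Xs"
  proof -
    have "nths Xs (- {length Xs}) = Xs"
      by (rule nths_all) auto
    then show ?thesis by (simp add: nths_append)
  qed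
  with move_to_front[OF assms, of "length Xs" "Xs @ [X]" X]
  have "f (X # Xs) = (-1) ^ length Xs *\<^sub>R f (Xs @ [X])" by simp
  then show ?thesis by (simp flip: power_mult_distrib)
qed

text \<open>An induction step for alternation: if all contractions are alternating, only repetitions that
  involve the first entry are left, and those reduce by \<open>move_to_front\<close> to equality of the first two
  entries.\<close>

lemma multilinear_alternating_SucI:
  assumes Nil: "f [] = 0" and lin: "\<And>Xs. linear (\<lambda>X. f (X # Xs))"
    and int: "\<And>X. contract_first X f \<in> multilinear_alternating k"
    and dbl: "\<And>X Xs. f (X # X # Xs) = 0"
  shows "f \<in> multilinear_alternating (Suc k)"
proof -
  have f_Cons: "f (X # Xs) = contract_first X f Xs" for X Xs
    by (simp add: contract_first_def)
  have repeat: "f (X # Xs) = 0" if "i < length Xs" "Xs ! i = X" for X Xs i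
    using move_to_front[OF int that(1), of X X] dbl[of X] that
    by (auto simp: contract_first_def)
  have "f Xs = 0" if "length Xs \<noteq> Suc k" for Xs
    using that Nil multilinear_alternating_off[OF int] by (cases Xs) (auto simp: f_Cons)
  moreover have "linear (\<lambda>X. f (Xs[i := X]))" if "i < length Xs" for Xs i
  proof (cases Xs)
    case (Cons Y Ys)
    then show ?thesis
      using that lin[of Ys] multilinear_alternating_linear[OF int[of Y], of "i - 1" Ys]
      by (cases i) (auto simp: contract_first_def)
  qed (use that in simp)
  moreover have "f Xs = 0" if "i < length Xs" "j < length Xs" "i \<noteq> j" "Xs ! i = Xs ! j" for Xs i j
  proof (cases Xs)
    case (Cons Y Ys)
    show ?thesis
    proof (cases "i = 0 \<or> j = 0")
      case True
      then have "\<exists>m<length Ys. Ys ! m = Y"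
        using that Cons by (auto simp: nth_Cons' split: if_splits
          intro: exI[of _ "i - 1"] exI[of _ "j - 1"])
      then show ?thesis using repeat Cons by blast
    next
      case False
      then show ?thesis
        using that Cons multilinear_alternating_equal[OF int[of Y], of "i - 1" Ys "j - 1"]
        by (auto simp: contract_first_def)
    qed
  qed (use that in simp)
  ultimately show ?thesis
    by (rule multilinear_alternatingI)
qed

section \<open>The Chevalley-Eilenberg differential\<close>

text \<open>The transpose of the derivation action \<open>ad\<^sub>X\<close> on multivectors; the coadjoint action of \<open>X\<close> is its
  negative. With this sign \<open>X \<mapsto> coad br X\<close> reverses brackets.\<close>

definition coad :: "('g \<Rightarrow> 'g \<Rightarrow> 'g) \<Rightarrow> 'g \<Rightarrow> ('g list \<Rightarrow> 'w::comm_monoid_add) \<Rightarrow> 'g list \<Rightarrow> 'w"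
  where "coad br X f = (\<lambda>Xs. \<Sum>i<length Xs. f (Xs[i := br X (Xs ! i)]))"

lemma coad_Cons: "coad br X f (Y # Ys) = f (br X Y # Ys) + coad br X (contract_first Y f) Ys"
  by (simp add: coad_def contract_first_def sum.lessThan_Suc_shift del: sum.lessThan_Suc)

lemma coad_Nil [simp]: "coad br X f [] = 0"
  by (simp add: coad_def)

lemma coad_add: "coad br X (f + g) = coad br X f + coad br X g"
  by (simp add: coad_def fun_eq_iff sum.distrib)

lemma contract_first_coad:
  "contract_first Y (coad br X f) = contract_first (br X Y) f + coad br X (contract_first Y f)"
  by (simp add: fun_eq_iff coad_Cons) (simp add: contract_first_def coad_Cons)

lemma lie_algebra_linear: "lie_algebra br \<Longrightarrow> linear (br X)" "lie_algebra br \<Longrightarrow> linear (\<lambda>Y. br Y X)"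
  by (auto simp: lie_algebra_def bilinear_def)

lemma linear_sum_right: "(\<And>i. i \<in> I \<Longrightarrow> linear (F i)) \<Longrightarrow> linear (\<lambda>x. \<Sum>i\<in>I. F i x)"
  by (rule linear_compose_sum) blast

lemma linear_coad_contract_first:
  "f \<in> multilinear_alternating k \<Longrightarrow> linear (\<lambda>Y. coad br X (contract_first Y f) Ys)"
  unfolding coad_def contract_first_def
  by (intro linear_sum_right multilinear_alternating_linear_Cons)

lemma coad_multilinear_alternating:
  assumes "lie_algebra br" "f \<in> multilinear_alternating k"
  shows "coad br X f \<in> multilinear_alternating k"
  using assms(2)
proof (induction k arbitrary: f)
  case 0
  then have "coad br X f = 0"
    by (intro ext) (auto simp: coad_def multilinear_alternating_off length_greater_0_conv[symmetric]
      simp del: length_greater_0_conv)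
  then show ?case
    using subspace_0[OF subspace_multilinear_alternating] by metis
next
  case (Suc k)
  have int: "contract_first Y f \<in> multilinear_alternating k" for Y
    using contract_first_multilinear_alternating[OF Suc.prems] by simp
  show ?case
  proof (rule multilinear_alternating_SucI)
    show "coad br X f [] = 0" by simp
    show "linear (\<lambda>Y. coad br X f (Y # Ys))" for Ys
      unfolding coad_Cons
      using linear_compose[OF lie_algebra_linear(1)[OF assms(1), of X]
          multilinear_alternating_linear_Cons[OF Suc.prems]]
      by (intro linear_compose_add linear_coad_contract_first[OF Suc.prems]) (simp add: o_def)
    show "contract_first Y (coad br X f) \<in> multilinear_alternating k" for Y
      unfolding contract_first_coad
      by (intro subspace_add[OF subspace_multilinear_alternating] Suc.IH int)
    show "coad br X f (Y # Y # Ys) = 0" for Y Ys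
    proof -
      have "contract_first Y (contract_first Y f) = 0"
        using multilinear_alternating_equal[OF Suc.prems, of 0 "Y # Y # _" 1]
        by (simp add: fun_eq_iff contract_first_def)
      then have "coad br X (contract_first Y (contract_first Y f)) Ys = 0"
        by (simp add: coad_def)
      then show ?thesis
        using swap_first_two[OF Suc.prems, of "br X Y" Y Ys]
        by (simp add: coad_Cons) (simp add: contract_first_def)
    qed
  qed
qed

text \<open>On a single argument this is the Jacobi identity; in higher degree contraction with the first
  argument \<open>Z\<close> reduces the degree, and the terms in which \<open>X\<close> and \<open>Y\<close> act on different arguments
  cancel.\<close>

lemma coad_commutator:
  assumes "lie_algebra br" "f \<in> multilinear_alternating k"
  shows "coad br X (coad br Y f) Xs - coad br Y (coad br X f) Xs = - coad br (br X Y) f Xs"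
  using assms(2)
proof (induction Xs arbitrary: f k)
  case (Cons Z Zs)
  have lin: "linear (\<lambda>U. f (U # Zs))"
    by (rule multilinear_alternating_linear_Cons[OF Cons.prems])
  have j: "br X (br Y Z) + br Y (br Z X) + br Z (br X Y) = 0"
    using assms(1) by (simp add: lie_algebra_def)
  have anti: "br U V = - br V U" for U V
  proof -
    have zero: "br W W = 0" for W
      using assms(1) by (simp add: lie_algebra_def)
    have "0 = br (U + V) (U + V)"
      by (simp add: zero)
    also have "\<dots> = br U V + br V U"
      by (simp add: linear_add[OF lie_algebra_linear(1)[OF assms(1)]]
        linear_add[OF lie_algebra_linear(2)[OF assms(1)]] zero[of U] zero[of V])
    finally show ?thesis
      by (metis eq_neg_iff_add_eq_0)
  qed
  have s: "br Y (br Z X) = - br Y (br X Z)"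
    by (simp add: anti[of Z X] linear_neg[OF lie_algebra_linear(1)[OF assms(1)]])
  have "br Y (br X Z) - br X (br Y Z) = - br (br X Y) Z"
    using j unfolding s anti[of Z "br X Y"] by (simp add: algebra_simps)
  then have jac: "f (br Y (br X Z) # Zs) - f (br X (br Y Z) # Zs) = - f (br (br X Y) Z # Zs)"
    by (simp flip: linear_diff[OF lin] linear_neg[OF lin])
  show ?case
    using jac Cons.IH[OF contract_first_multilinear_alternating[OF Cons.prems], of Z]
    by (simp add: coad_Cons contract_first_coad coad_add algebra_simps)
qed simp

lemma ce_diff_Nil [simp]: "ce_diff br f [] = 0"
  by (simp add: ce_diff_def)

lemma ce_diff_add: "ce_diff br (f + g) = ce_diff br f + ce_diff br g"
  by (simp add: ce_diff_def fun_eq_iff sum.distrib algebra_simps)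

text \<open>Cartan's formula. The pairs \<open>(0, j)\<close> in the differential put \<open>[Y, Y\<^sub>j]\<close> in front, and moving it back
  into its position gives \<open>coad\<close>; in the remaining pairs \<open>Y\<close> stands second, and exchanging it with the
  bracket gives the differential of the contraction, with a minus sign.\<close>

lemma ce_diff_Cons:
  fixes f :: "'g::real_vector list \<Rightarrow> real"
  assumes f: "f \<in> multilinear_alternating k"
  shows "ce_diff br f (Y # Ys) = - coad br Y f Ys - ce_diff br (contract_first Y f) Ys"
proof -
  define t where "t i j = (-1) ^ (i + j) *
    f (br ((Y # Ys) ! i) ((Y # Ys) ! j) # nths (Y # Ys) (- {i, j}))" for i j
  have t0: "t 0 (Suc j) = - f (Ys[j := br Y (Ys ! j)])" if "j < length Ys" for j
  proof -
    have "{i. Suc i \<in> - {0, Suc j}} = - {j}" by auto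
    then have "t 0 (Suc j) = (-1) ^ Suc j * f (br Y (Ys ! j) # nths Ys (- {j}))"
      by (simp add: t_def nths_Cons)
    also have "\<dots> = (-1) ^ Suc j * (-1) ^ j * f (Ys[j := br Y (Ys ! j)])"
      by (simp add: move_to_front[OF f that])
    also have "(-1) ^ Suc j * (-1) ^ j = (-1::real)"
      by (simp flip: power_mult_distrib)
    finally show ?thesis by simp
  qed
  have tS: "t (Suc i) (Suc j) =
      - ((-1) ^ (i + j) * contract_first Y f (br (Ys ! i) (Ys ! j) # nths Ys (- {i, j})))" for i j
  proof -
    have "{l. Suc l \<in> - {Suc i, Suc j}} = - {i, j}" by auto
    then show ?thesis
      using swap_first_two[OF f, of "br (Ys ! i) (Ys ! j)" Y]
      by (simp add: t_def nths_Cons contract_first_def)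
  qed
  have "ce_diff br f (Y # Ys) = (\<Sum>j<Suc (length Ys). \<Sum>i<j. t i j)"
    by (simp add: ce_diff_def t_def)
  also have "\<dots> = (\<Sum>j<length Ys. t 0 (Suc j) + (\<Sum>i<j. t (Suc i) (Suc j)))"
    by (simp add: sum.lessThan_Suc_shift del: sum.lessThan_Suc)
  also have "\<dots> = - coad br Y f Ys - ce_diff br (contract_first Y f) Ys"
    by (simp add: sum.distrib t0 tS sum_negf sum_subtractf coad_def ce_diff_def)
  finally show ?thesis .
qed

lemma contract_first_ce_diff:
  fixes f :: "'g::real_vector list \<Rightarrow> real"
  assumes "f \<in> multilinear_alternating k"
  shows "contract_first Y (ce_diff br f) = - coad br Y f - ce_diff br (contract_first Y f)"
  using ce_diff_Cons[OF assms, of br Y] by (simp add: contract_first_def fun_eq_iff)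

text \<open>Proved from Cartan's formula by induction on the degree, which avoids tracking two omitted
  positions at a time: contractions of \<open>\<delta>f\<close> are expressed by \<open>coad\<close> and by \<open>\<delta>\<close> in lower degree, and
  applying the formula twice gives \<open>\<delta>f (Y, Y, \<dots>) = 0\<close>.\<close>

lemma ce_diff_multilinear_alternating:
  fixes f :: "'g::real_vector list \<Rightarrow> real"
  assumes br: "lie_algebra br" and "f \<in> multilinear_alternating k"
  shows "ce_diff br f \<in> multilinear_alternating (Suc k)"
  using assms(2)
proof (induction k arbitrary: f)
  case 0
  then have "ce_diff br f = 0"
    by (auto simp: fun_eq_iff ce_diff_def multilinear_alternating_off)
  then show ?case
    using subspace_0[OF subspace_multilinear_alternating] by metis
next
  case (Suc k)
  note lin_f = multilinear_alternating_linear[OF Suc.prems]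
  have int: "contract_first Y f \<in> multilinear_alternating k" for Y
    using contract_first_multilinear_alternating[OF Suc.prems] by simp
  show ?case
  proof (rule multilinear_alternating_SucI)
    show "ce_diff br f [] = 0" by simp
    show "linear (\<lambda>Y. ce_diff br f (Y # Ys))" for Ys
    proof -
      have "linear (\<lambda>Y. coad br Y f Ys)"
        unfolding coad_def
      proof (rule linear_sum_right)
        fix i assume "i \<in> {..<length Ys}"
        then show "linear (\<lambda>Y. f (Ys[i := br Y (Ys ! i)]))"
          using linear_compose[OF lie_algebra_linear(2)[OF br, of "Ys ! i"] lin_f[of i Ys]]
          by (simp add: o_def)
      qed
      moreover have "linear (\<lambda>Y. ce_diff br (contract_first Y f) Ys)"
        unfolding ce_diff_def contract_first_def real_scaleR_def[symmetric]
        by (intro linear_sum_right linear_compose_scale_right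
          multilinear_alternating_linear_Cons[OF Suc.prems])
      ultimately show ?thesis
        unfolding ce_diff_Cons[OF Suc.prems]
        by (intro linear_compose_sub linear_compose_neg)
    qed
    show "contract_first Y (ce_diff br f) \<in> multilinear_alternating (Suc k)" for Y
      unfolding contract_first_ce_diff[OF Suc.prems]
      by (intro subspace_diff[OF subspace_multilinear_alternating]
        subspace_neg[OF subspace_multilinear_alternating]
        coad_multilinear_alternating[OF br Suc.prems] Suc.IH int)
    show "ce_diff br f (Y # Y # Ys) = 0" for Y Ys
    proof -
      have "contract_first Y (contract_first Y f) = 0"
        using multilinear_alternating_equal[OF Suc.prems, of 0 "Y # Y # _" 1]
        by (simp add: fun_eq_iff contract_first_def)
      then have "ce_diff br (contract_first Y (contract_first Y f)) Ys = 0"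
        by (simp add: ce_diff_def)
      moreover have "br Y Y = 0" "f (0 # Ys) = 0"
        using br linear_0[OF multilinear_alternating_linear_Cons[OF Suc.prems]]
        by (auto simp: lie_algebra_def)
      ultimately show ?thesis
        by (simp add: ce_diff_Cons[OF Suc.prems] ce_diff_Cons[OF int] coad_Cons)
    qed
  qed
qed

text \<open>The action commutes with the differential. Contract with the first argument on both sides: by
  Cartan's formula the difference is the commutator relation for \<open>coad\<close> plus the same
  statement in lower degree. In consequence the Lie kernel is stable under \<open>ad\<^sub>X\<close>.\<close>

lemma coad_ce_diff:
  fixes f :: "'g::real_vector list \<Rightarrow> real"
  assumes br: "lie_algebra br" and "f \<in> multilinear_alternating k"
  shows "coad br X (ce_diff br f) Xs = ce_diff br (coad br X f) Xs"
  using assms(2)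
proof (induction Xs arbitrary: f k)
  case (Cons Y Ys)
  note int = contract_first_multilinear_alternating[OF Cons.prems]
  note coad = coad_multilinear_alternating[OF br Cons.prems]
  have "coad br X (- coad br Y f - ce_diff br (contract_first Y f)) Ys =
      - coad br X (coad br Y f) Ys - coad br X (ce_diff br (contract_first Y f)) Ys"
    by (simp add: coad_def sum_subtractf sum_negf)
  then have "coad br X (ce_diff br f) (Y # Ys) =
      - coad br (br X Y) f Ys - ce_diff br (contract_first (br X Y) f) Ys
      - coad br X (coad br Y f) Ys - ce_diff br (coad br X (contract_first Y f)) Ys"
    by (simp add: coad_Cons ce_diff_Cons[OF Cons.prems] contract_first_ce_diff[OF Cons.prems] Cons.IH[OF int])
  also have "\<dots> = ce_diff br (coad br X f) (Y # Ys)"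
    using coad_commutator[OF br Cons.prems, of X Y Ys]
    by (simp add: ce_diff_Cons[OF coad] contract_first_coad ce_diff_add)
  finally show ?case .
qed simp


section \<open>Presentations of alternating maps and of multivectors\<close>

lemma finite_tuples: "finite B \<Longrightarrow> finite (tuples k B)"
  using finite_lists_length_eq[of B k] by (simp add: tuples_def conj_commute)

lemma alternating_values_in_span:
  fixes F :: "'g::real_vector list \<Rightarrow> 'w::real_vector" and B :: "'g set"
  assumes "F \<in> multilinear_alternating k" and B: "span B = UNIV"
  shows "F Xs \<in> span (F ` tuples k B)"
  using assms(1)
proof (induction k arbitrary: F Xs)
  case 0
  show ?case
  proof (cases "Xs = []")
    case True
    then show ?thesis by (auto intro!: span_base simp: tuples_def)
  next
    case False
    then show ?thesis using multilinear_alternating_off[OF 0, of Xs] by (simp add: span_zero)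
  qed
next
  case (Suc k)
  show ?case
  proof (cases Xs)
    case Nil
    then show ?thesis using multilinear_alternating_off[OF Suc.prems, of Xs] by (simp add: span_zero)
  next
    case (Cons Y Ys)
    have "F (Y # bs) \<in> span (F ` tuples (Suc k) B)" if "bs \<in> tuples k B" for bs
    proof -
      have lin: "linear (\<lambda>X. F (X # bs))"
        by (rule multilinear_alternating_linear_Cons[OF Suc.prems])
      have "F (Y # bs) \<in> (\<lambda>X. F (X # bs)) ` span B"
        by (simp add: B)
      then have "F (Y # bs) \<in> span ((\<lambda>X. F (X # bs)) ` B)"
        by (simp only: linear_span_image[OF lin])
      moreover have "(\<lambda>X. F (X # bs)) ` B \<subseteq> F ` tuples (Suc k) B"
        using that by (auto simp: tuples_def)
      ultimately show ?thesis using span_mono by blast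
    qed
    then have "span (contract_first Y F ` tuples k B) \<subseteq> span (F ` tuples (Suc k) B)"
      by (intro span_minimal) (auto simp: contract_first_def)
    moreover have "contract_first Y F Ys \<in> span (contract_first Y F ` tuples k B)"
      using Suc.IH contract_first_multilinear_alternating[OF Suc.prems] by simp
    ultimately show ?thesis by (auto simp: Cons contract_first_def)
  qed
qed

text \<open>For finite-dimensional \<open>\<gg>\<close> the values of \<open>F\<close> span a finite-dimensional space. Expanding \<open>F\<close> in a
  basis of that space gives a tensor presentation whose coefficients are alternating because they are
  linear functions of \<open>F\<close>; no basis of \<open>\<Lambda>\<^sup>k \<gg>\<^sup>*\<close> has to be constructed.\<close>

lemma alternating_map_presentation:
  fixes F :: "'g::real_vector list \<Rightarrow> 'w::real_vector" and B :: "'g set"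
  assumes F: "F \<in> multilinear_alternating k" and B: "finite B" "span B = UNIV"
  shows "\<exists>ts. set ts \<subseteq> ext_forms k \<times> range F \<and> F = (\<lambda>Xs. \<Sum>(f, \<alpha>)\<leftarrow>ts. f Xs *\<^sub>R \<alpha>)"
proof -
  obtain S where S: "S \<subseteq> F ` tuples k B" "independent S" "F ` tuples k B \<subseteq> span S"
    using maximal_independent_subset by blast
  have "finite S"
    using S(1) finite_tuples[OF B(1)] finite_surj by blast
  then obtain ws where ws: "set ws = S" "distinct ws"
    using finite_distinct_list by blast
  have in_span: "F Xs \<in> span S" for Xs
    using alternating_values_in_span[OF F B(2)] span_minimal[OF S(3)] by auto
  have "(\<lambda>Xs. representation S (F Xs) w) \<in> ext_forms k" for w
    unfolding ext_forms_def
  proof (rule multilinear_alternatingI)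
    fix Xs :: "'g list" and i
    assume "i < length Xs"
    then have lin: "linear (\<lambda>X. F (Xs[i := X]))"
      by (rule multilinear_alternating_linear[OF F])
    show "linear (\<lambda>X. representation S (F (Xs[i := X])) w)"
      by (rule linearI) (simp_all add: linear_add[OF lin] linear_scale[OF lin]
        representation_add[OF S(2) in_span in_span] representation_scale[OF S(2) in_span])
  qed (simp_all add: multilinear_alternating_off[OF F] multilinear_alternating_equal[OF F]
      representation_zero)
  moreover have "F Xs = (\<Sum>w\<leftarrow>ws. representation S (F Xs) w *\<^sub>R w)" for Xs
    using sum_representation_eq[OF S(2) in_span \<open>finite S\<close> order_refl, of Xs] ws
    by (simp add: sum_list_distinct_conv_sum_set)
  ultimately show ?thesis
    using ws(1) S(1)
    by (intro exI[of _ "map (\<lambda>w. (\<lambda>Xs. representation S (F Xs) w, w)) ws"])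
      (auto simp: o_def fun_eq_iff)
qed

lemma wedge_sum_eval:
  assumes "set ts \<subseteq> tuples n UNIV" "f \<in> ext_forms n"
  shows "(\<Sum>Xs\<leftarrow>ts. wedge Xs) f = (\<Sum>Xs\<leftarrow>ts. f Xs)"
  unfolding sum_list_apply
  using assms by (intro arg_cong[where f = sum_list] map_cong) (auto simp: wedge_def tuples_def)

text \<open>In positive degree the scalars of a linear combination can be absorbed into the first factors.\<close>

lemma ext_power_presentation:
  fixes p :: "'g::real_vector multivector"
  assumes n: "n \<ge> 1" and "p \<in> ext_power n"
  shows "\<exists>ts. set ts \<subseteq> tuples n UNIV \<and> p = (\<Sum>Xs\<leftarrow>ts. wedge Xs)"
proof -
  let ?S = "{p :: 'g multivector. \<exists>ts. set ts \<subseteq> tuples n UNIV \<and> p = (\<Sum>Xs\<leftarrow>ts. wedge Xs)}"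
  have "span (wedge ` tuples n UNIV) \<subseteq> ?S"
  proof (rule span_minimal)
    show "wedge ` tuples n UNIV \<subseteq> ?S"
      by (auto intro!: exI[of _ "[_]"])
    show "subspace ?S"
      unfolding subspace_def
    proof (intro conjI ballI allI)
      show "0 \<in> ?S" by (auto intro: exI[of _ "[]"])
      show "p + q \<in> ?S" if "p \<in> ?S" "q \<in> ?S" for p q
      proof -
        from that obtain ts us where "set ts \<subseteq> tuples n UNIV" "p = (\<Sum>Xs\<leftarrow>ts. wedge Xs)"
          "set us \<subseteq> tuples n UNIV" "q = (\<Sum>Xs\<leftarrow>us. wedge Xs)" by auto
        then show ?thesis by (auto intro!: exI[of _ "ts @ us"])
      qed
      show "c *\<^sub>R p \<in> ?S" if "p \<in> ?S" for p and c :: real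
      proof -
        from that obtain ts where ts: "set ts \<subseteq> tuples n UNIV" "p = (\<Sum>Xs\<leftarrow>ts. wedge Xs)" by auto
        have "wedge (Xs[0 := c *\<^sub>R (Xs ! 0)]) = c *\<^sub>R wedge Xs" if "Xs \<in> tuples n UNIV" for Xs :: "'g list"
        proof
          fix f :: "'g list \<Rightarrow> real"
          have "0 < length Xs" using that n by (auto simp: tuples_def)
          then have "f (Xs[0 := c *\<^sub>R (Xs ! 0)]) = c * f Xs" if "f \<in> ext_forms n"
            using linear_scale[OF multilinear_alternating_linear, of f n 0 Xs c "Xs ! 0"] that
            by (simp add: ext_forms_def)
          then show "wedge (Xs[0 := c *\<^sub>R (Xs ! 0)]) f = (c *\<^sub>R wedge Xs) f"
            using that by (simp add: wedge_def tuples_def)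
        qed
        then have "(\<Sum>Xs\<leftarrow>ts. wedge (Xs[0 := c *\<^sub>R (Xs ! 0)])) = (\<Sum>Xs\<leftarrow>ts. c *\<^sub>R wedge Xs)"
          using ts(1) by (intro arg_cong[where f = sum_list] map_cong) auto
        also have "\<dots> = c *\<^sub>R p"
          unfolding ts(2) by (rule scaleR_sum_list)
        finally have "c *\<^sub>R p = (\<Sum>Xs\<leftarrow>map (\<lambda>Xs. Xs[0 := c *\<^sub>R (Xs ! 0)]) ts. wedge Xs)"
          by (simp add: o_def)
        moreover have "set (map (\<lambda>Xs. Xs[0 := c *\<^sub>R (Xs ! 0)]) ts) \<subseteq> tuples n UNIV"
          using ts(1) by (auto simp: tuples_def)
        ultimately show ?thesis by blast
      qed
    qed
  qed
  then show ?thesis using assms(2) by (auto simp: ext_power_def)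
qed

lemma wedge_terms:
  assumes "n \<ge> 1" "p \<in> ext_power n"
  shows "set (wedge_terms n p) \<subseteq> tuples n UNIV" "p = (\<Sum>Xs\<leftarrow>wedge_terms n p. wedge Xs)"
  using someI_ex[OF ext_power_presentation[OF assms]] by (simp_all add: wedge_terms_def)

text \<open>The action \<open>ad\<^sub>X\<close> at the level of presentations: a list of wedge factors for \<open>p\<close> becomes one for
  \<open>ad\<^sub>X p\<close>. Facts about \<open>p\<close> that hold for every presentation can thus be applied to \<open>ad\<^sub>X p\<close> without
  referring to the presentation that happens to be chosen for it.\<close>

definition ad_terms :: "('g \<Rightarrow> 'g \<Rightarrow> 'g) \<Rightarrow> 'g \<Rightarrow> 'g list list \<Rightarrow> 'g list list"
  where "ad_terms br X ts = concat (map (\<lambda>Xs. map (\<lambda>i. Xs[i := br X (Xs ! i)]) [0..<length Xs]) ts)"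

lemma sum_list_ad_terms: "(\<Sum>Xs\<leftarrow>ad_terms br X ts. F Xs) = (\<Sum>Xs\<leftarrow>ts. coad br X F Xs)"
  by (induction ts)
    (simp_all add: ad_terms_def coad_def o_def interv_sum_list_conv_sum_set_nat atLeast0LessThan)

lemma ad_terms_tuples: "set ts \<subseteq> tuples n UNIV \<Longrightarrow> set (ad_terms br X ts) \<subseteq> tuples n UNIV"
  by (auto simp: ad_terms_def tuples_def)

lemma ad_action_eq_ad_terms:
  assumes "n \<ge> 1" "p \<in> ext_power n"
  shows "ad_action br n X p = (\<Sum>Xs\<leftarrow>ad_terms br X (wedge_terms n p). wedge Xs)"
  unfolding ad_action_def sum_list_ad_terms coad_def
  using wedge_terms(1)[OF assms]
  by (intro arg_cong[where f = sum_list] map_cong) (auto simp: tuples_def)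

lemma lie_kernel_exact_eval:
  assumes "p \<in> lie_kernel br n" "f \<in> ext_forms (n - 1)"
  shows "p (ce_diff br f) = 0"
proof -
  have "ce_codiff br n p f = 0" using assms(1) by (simp add: lie_kernel_def)
  then show ?thesis using assms(2) by (simp add: ce_codiff_def)
qed

lemma ad_action_lie_kernel:
  assumes br: "lie_algebra br" and n: "n \<ge> 1" and p: "p \<in> lie_kernel br n"
  shows "ad_action br n X p \<in> lie_kernel br n"
proof -
  have p': "p \<in> ext_power n" using p by (simp add: lie_kernel_def)
  note ts = wedge_terms[OF n p']
  have "ad_action br n X p (ce_diff br f) = 0" if f: "f \<in> ext_forms (n - 1)" for f
  proof -
    have df: "ce_diff br f \<in> ext_forms n" "ce_diff br (coad br X f) \<in> ext_forms n"
      using ce_diff_multilinear_alternating[OF br, of _ "n - 1"] f n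
        coad_multilinear_alternating[OF br]
      by (auto simp: ext_forms_def)
    have "ad_action br n X p (ce_diff br f) = (\<Sum>Xs\<leftarrow>wedge_terms n p. coad br X (ce_diff br f) Xs)"
      unfolding ad_action_eq_ad_terms[OF n p'] wedge_sum_eval[OF ad_terms_tuples[OF ts(1)] df(1)]
      by (rule sum_list_ad_terms)
    also have "\<dots> = (\<Sum>Xs\<leftarrow>wedge_terms n p. ce_diff br (coad br X f) Xs)"
      using coad_ce_diff[OF br] f by (simp add: ext_forms_def)
    also have "\<dots> = p (ce_diff br (coad br X f))"
      unfolding ts(2)[symmetric] wedge_sum_eval[OF ts(1) df(2), symmetric] ..
    also have "\<dots> = 0"
      using lie_kernel_exact_eval[OF p, of "coad br X f"] coad_multilinear_alternating[OF br, of f "n - 1" X] f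
      by (simp add: ext_forms_def)
    finally show ?thesis .
  qed
  moreover have "ad_action br n X p \<in> ext_power n"
  proof -
    have "(\<Sum>Xs\<leftarrow>us. wedge Xs) \<in> ext_power n" if "set us \<subseteq> tuples n UNIV" for us :: "'a list list"
      unfolding ext_power_def using that by (intro subspace_sum_list subspace_span) (auto intro: span_base)
    from this[OF ad_terms_tuples[OF ts(1)]] show ?thesis
      unfolding ad_action_eq_ad_terms[OF n p'] .
  qed
  ultimately show ?thesis by (simp add: lie_kernel_def ce_codiff_def fun_eq_iff)
qed

section \<open>Vanishing in a tensor product of quotient spaces\<close>

lemma lookup_scaleR: "Poly_Mapping.lookup (c *\<^sub>R z) x = c *\<^sub>R Poly_Mapping.lookup z x"
  by (simp add: scaleR_poly_mapping_def map.rep_eq when_def)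

text \<open>The universal property of the free vector space on \<open>'x\<close>.\<close>

lemma linear_extension_from_generators:
  fixes \<psi> :: "'x \<Rightarrow> 'u::real_vector"
  shows "\<exists>\<Psi>. linear \<Psi> \<and> (\<forall>x. \<Psi> (Poly_Mapping.single x (1::real)) = \<psi> x)"
proof -
  define \<Psi> where "\<Psi> z = (\<Sum>x\<in>Poly_Mapping.keys z. Poly_Mapping.lookup z x *\<^sub>R \<psi> x)"
    for z :: "'x \<Rightarrow>\<^sub>0 real"
  have super: "\<Psi> z = (\<Sum>x\<in>S. Poly_Mapping.lookup z x *\<^sub>R \<psi> x)"
    if "finite S" "Poly_Mapping.keys z \<subseteq> S" for z S
    unfolding \<Psi>_def using that by (intro sum.mono_neutral_left) (auto simp: in_keys_iff)
  have "linear \<Psi>"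
  proof (rule linearI)
    fix y z :: "'x \<Rightarrow>\<^sub>0 real" and c :: real
    let ?S = "Poly_Mapping.keys y \<union> Poly_Mapping.keys z"
    have "Poly_Mapping.keys (y + z) \<subseteq> ?S"
      by (rule Poly_Mapping.keys_add)
    then show "\<Psi> (y + z) = \<Psi> y + \<Psi> z"
      using super[of ?S] by (simp add: lookup_add scaleR_add_left sum.distrib)
    have "Poly_Mapping.keys (c *\<^sub>R y) \<subseteq> Poly_Mapping.keys y"
      by (auto simp: in_keys_iff lookup_scaleR)
    then show "\<Psi> (c *\<^sub>R y) = c *\<^sub>R \<Psi> y"
      using super[of "Poly_Mapping.keys y"] by (simp add: scaleR_sum_right lookup_scaleR)
  qed
  moreover have "\<Psi> (Poly_Mapping.single x 1) = \<psi> x" for x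
    using super[of "{x}" "Poly_Mapping.single x 1"] by simp
  ultimately show ?thesis by blast
qed

text \<open>The kernel of \<open>V \<otimes> W \<rightarrow> V/N \<otimes> W/K\<close> is \<open>N \<otimes> W + V \<otimes> K\<close>, in the form of its image under a bilinear
  map \<open>h\<close>. Choosing representatives defines a linear map \<open>\<Psi>\<close> on formal tensors. It need not vanish on
  the relations, but modulo the right-hand span it agrees with \<open>h\<close> on representatives, since
  \<open>h (x + a) (y + b) - h x y = h a y + h x b + h a b\<close>; so it sends the relations into that span.\<close>

lemma quotient_tensor_eq_zeroD:
  fixes h :: "'v::real_vector \<Rightarrow> 'w::real_vector \<Rightarrow> 'u::real_vector"
  assumes h: "bilinear h" and V: "subspace V" and W: "subspace W"
    and N: "N \<subseteq> V" "0 \<in> N" and K: "0 \<in> K"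
    and ts: "set ts \<subseteq> V \<times> W"
    and zero: "quotient_tensor V N W K
      (\<Sum>(x, y)\<leftarrow>ts. formal_tensor (residue_class N x) (residue_class K y)) = quotient_tensor V N W K 0"
  shows "(\<Sum>(x, y)\<leftarrow>ts. h x y) \<in> span ({h x y | x y. x \<in> N \<and> y \<in> W} \<union> {h x y | x y. x \<in> V \<and> y \<in> K})"
    (is "_ \<in> span ?T")
proof -
  let ?q = "residue_class N" and ?r = "residue_class K"
  obtain \<Psi> where lin: "linear \<Psi>"
    and \<Psi>: "\<And>A B. \<Psi> (formal_tensor A B) = h (SOME a. a \<in> A) (SOME b. b \<in> B)"
    using linear_extension_from_generators[of "\<lambda>(A, B). h (SOME a. a \<in> A) (SOME b. b \<in> B)"]
    unfolding formal_tensor_def by auto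
  have rep: "\<Psi> (formal_tensor (?q x) (?r y)) - h x y \<in> span ?T" if xy: "x \<in> V" "y \<in> W" for x y
  proof -
    have "x \<in> ?q x" "y \<in> ?r y"
      using N K unfolding residue_class_def by force+
    then have "(SOME a. a \<in> ?q x) \<in> ?q x" "(SOME b. b \<in> ?r y) \<in> ?r y"
      by (auto intro: someI)
    then obtain a b where "a \<in> N" "b \<in> K" and ab: "(SOME a. a \<in> ?q x) = x + a" "(SOME b. b \<in> ?r y) = y + b"
      by (auto simp: residue_class_def)
    then have "h a y \<in> span ?T" "h x b \<in> span ?T" "h a b \<in> span ?T"
      using xy N by (auto intro!: span_base)
    moreover have "\<Psi> (formal_tensor (?q x) (?r y)) - h x y = h a y + h x b + h a b"
      unfolding \<Psi> ab by (simp add: bilinear_ladd[OF h] bilinear_radd[OF h])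
    ultimately show ?thesis by (simp add: span_add)
  qed
  have "z \<in> \<Psi> -` span ?T" if z: "z \<in> tensor_relations V N W K" for z
  proof -
    consider (left) x x' y where "x \<in> V" "x' \<in> V" "y \<in> W"
        "z = formal_tensor (?q (x + x')) (?r y) - formal_tensor (?q x) (?r y) - formal_tensor (?q x') (?r y)"
      | (right) x y y' where "x \<in> V" "y \<in> W" "y' \<in> W"
        "z = formal_tensor (?q x) (?r (y + y')) - formal_tensor (?q x) (?r y) - formal_tensor (?q x) (?r y')"
      | (sleft) c x y where "x \<in> V" "y \<in> W"
        "z = formal_tensor (?q (c *\<^sub>R x)) (?r y) - c *\<^sub>R formal_tensor (?q x) (?r y)"
      | (sright) c x y where "x \<in> V" "y \<in> W"
        "z = formal_tensor (?q x) (?r (c *\<^sub>R y)) - c *\<^sub>R formal_tensor (?q x) (?r y)"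
      using z unfolding tensor_relations_def by blast
    then have "\<Psi> z \<in> span ?T"
    proof cases
      case left
      have "\<Psi> z = (\<Psi> (formal_tensor (?q (x + x')) (?r y)) - h (x + x') y)
          - (\<Psi> (formal_tensor (?q x) (?r y)) - h x y) - (\<Psi> (formal_tensor (?q x') (?r y)) - h x' y)"
        by (simp add: left linear_diff[OF lin] bilinear_ladd[OF h])
      then show ?thesis
        by (simp only:) (intro span_diff rep left subspace_add[OF V])
    next
      case right
      have "\<Psi> z = (\<Psi> (formal_tensor (?q x) (?r (y + y'))) - h x (y + y'))
          - (\<Psi> (formal_tensor (?q x) (?r y)) - h x y) - (\<Psi> (formal_tensor (?q x) (?r y')) - h x y')"
        by (simp add: right linear_diff[OF lin] bilinear_radd[OF h])
      then show ?thesis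
        by (simp only:) (intro span_diff rep right subspace_add[OF W])
    next
      case sleft
      have "\<Psi> z = (\<Psi> (formal_tensor (?q (c *\<^sub>R x)) (?r y)) - h (c *\<^sub>R x) y)
          - c *\<^sub>R (\<Psi> (formal_tensor (?q x) (?r y)) - h x y)"
        by (simp add: sleft linear_diff[OF lin] linear_scale[OF lin] bilinear_lmul[OF h] scaleR_diff_right)
      then show ?thesis
        by (simp only:) (intro span_diff span_scale rep sleft subspace_scale[OF V])
    next
      case sright
      have "\<Psi> z = (\<Psi> (formal_tensor (?q x) (?r (c *\<^sub>R y))) - h x (c *\<^sub>R y))
          - c *\<^sub>R (\<Psi> (formal_tensor (?q x) (?r y)) - h x y)"
        by (simp add: sright linear_diff[OF lin] linear_scale[OF lin] bilinear_rmul[OF h] scaleR_diff_right)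
      then show ?thesis
        by (simp only:) (intro span_diff span_scale rep sright subspace_scale[OF W])
    qed
    then show ?thesis by simp
  qed
  then have rel: "span (tensor_relations V N W K) \<subseteq> \<Psi> -` span ?T"
    by (intro span_minimal linear_subspace_vimage[OF lin] subspace_span) auto
  let ?z = "\<Sum>(x, y)\<leftarrow>ts. formal_tensor (?q x) (?r y)"
  have "?z \<in> residue_class (span (tensor_relations V N W K)) ?z"
    unfolding residue_class_def using span_zero by force
  then have "?z \<in> span (tensor_relations V N W K)"
    using zero unfolding quotient_tensor_def residue_class_def by auto
  then have "\<Psi> ?z \<in> span ?T"
    using rel by auto
  moreover have "\<Psi> ?z - (\<Sum>(x, y)\<leftarrow>ts. h x y) \<in> span ?T"
    using ts
  proof (induction ts)
    case Nil
    then show ?case by (simp add: linear_0[OF lin] span_zero)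
  next
    case (Cons t ts)
    then obtain x y where "t = (x, y)" "x \<in> V" "y \<in> W" by auto
    then show ?case
      using span_add[OF rep[of x y] Cons.IH] Cons.prems
      by (simp add: linear_add[OF lin] algebra_simps)
  qed
  ultimately show ?thesis
    using span_diff by fastforce
qed


section \<open>Smooth functions, vector fields and forms\<close>

lemma Ck_on_imp_continuous_on: "Ck_on k E S f \<Longrightarrow> continuous_on S f"
  by (cases k) auto

lemma Ck_on_Suc_imp_Ck_on: "Ck_on (Suc k) E S f \<Longrightarrow> Ck_on k E S f"
proof (induction k arbitrary: f)
  case (Suc k)
  show ?case
    unfolding Ck_on.simps(2)[of k]
  proof (intro conjI ballI)
    show "continuous_on S f" by (rule Ck_on_imp_continuous_on[OF Suc.prems])
    fix v assume "v \<in> E"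
    then obtain g where "\<forall>x\<in>S. ((\<lambda>t. f (x + t *\<^sub>R v)) has_vector_derivative g x) (at 0)" "Ck_on (Suc k) E S g"
      using Suc.prems unfolding Ck_on.simps(2)[of "Suc k"] by blast
    then show "\<exists>g. (\<forall>x\<in>S. ((\<lambda>t. f (x + t *\<^sub>R v)) has_vector_derivative g x) (at 0)) \<and> Ck_on k E S g"
      using Suc.IH by blast
  qed
qed simp

lemma Ck_on_const: "Ck_on k E S (\<lambda>_. c)"
  by (induction k arbitrary: c) (auto intro!: exI[of _ "\<lambda>_. 0"])

lemma Ck_on_add: "Ck_on k E S f \<Longrightarrow> Ck_on k E S g \<Longrightarrow> Ck_on k E S (\<lambda>x. f x + g x)"
proof (induction k arbitrary: f g)
  case (Suc k)
  show ?case
    unfolding Ck_on.simps(2)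
  proof (intro conjI ballI)
    show "continuous_on S (\<lambda>x. f x + g x)"
      using Suc.prems by (intro continuous_on_add Ck_on_imp_continuous_on)
    fix v assume v: "v \<in> E"
    obtain f' where
      f': "\<forall>x\<in>S. ((\<lambda>t. f (x + t *\<^sub>R v)) has_vector_derivative f' x) (at 0)" "Ck_on k E S f'"
      using Suc.prems(1) v by auto
    obtain g' where
      g': "\<forall>x\<in>S. ((\<lambda>t. g (x + t *\<^sub>R v)) has_vector_derivative g' x) (at 0)" "Ck_on k E S g'"
      using Suc.prems(2) v by auto
    from f' g' show "\<exists>h. (\<forall>x\<in>S. ((\<lambda>t. f (x + t *\<^sub>R v) + g (x + t *\<^sub>R v)) has_vector_derivative h x) (at 0))
        \<and> Ck_on k E S h"
      using Suc.IH[OF f'(2) g'(2)] by (intro exI[of _ "\<lambda>x. f' x + g' x"]) (auto intro: has_vector_derivative_add)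
  qed
qed (simp add: continuous_on_add)

lemma Ck_on_mult:
  fixes f g :: "'e::real_normed_vector \<Rightarrow> real"
  shows "Ck_on k E S f \<Longrightarrow> Ck_on k E S g \<Longrightarrow> Ck_on k E S (\<lambda>x. f x * g x)"
proof (induction k arbitrary: f g)
  case (Suc k)
  show ?case
    unfolding Ck_on.simps(2)
  proof (intro conjI ballI)
    show "continuous_on S (\<lambda>x. f x * g x)"
      using Suc.prems by (intro continuous_on_mult Ck_on_imp_continuous_on)
    fix v assume v: "v \<in> E"
    obtain f' where
      f': "\<forall>x\<in>S. ((\<lambda>t. f (x + t *\<^sub>R v)) has_vector_derivative f' x) (at 0)" "Ck_on k E S f'"
      using Suc.prems(1) v by auto
    obtain g' where
      g': "\<forall>x\<in>S. ((\<lambda>t. g (x + t *\<^sub>R v)) has_vector_derivative g' x) (at 0)" "Ck_on k E S g'"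
      using Suc.prems(2) v by auto
    have "((\<lambda>t. f (x + t *\<^sub>R v) * g (x + t *\<^sub>R v)) has_vector_derivative f x * g' x + f' x * g x) (at 0)"
      if "x \<in> S" for x
      using has_vector_derivative_mult[OF f'(1)[rule_format, OF that] g'(1)[rule_format, OF that]] by simp
    moreover have "Ck_on k E S (\<lambda>x. f x * g' x + f' x * g x)"
      using Ck_on_Suc_imp_Ck_on[OF Suc.prems(1)] Ck_on_Suc_imp_Ck_on[OF Suc.prems(2)] f'(2) g'(2)
      by (intro Ck_on_add Suc.IH)
    ultimately show "\<exists>h. (\<forall>x\<in>S. ((\<lambda>t. f (x + t *\<^sub>R v) * g (x + t *\<^sub>R v)) has_vector_derivative h x) (at 0))
        \<and> Ck_on k E S h"
      by (intro exI[of _ "\<lambda>x. f x * g' x + f' x * g x"]) auto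
  qed
qed (simp add: continuous_on_mult)

lemma smooth_functions_iff:
  "f \<in> smooth_functions (E, A) \<longleftrightarrow>
    (\<forall>(U, \<phi>)\<in>A. \<forall>k. Ck_on k E (\<phi> ` U) (\<lambda>x. f (inv_into U \<phi> x)))"
  by (simp add: smooth_functions_def smooth_on_def o_def)

lemma smooth_functions_const: "(\<lambda>_. c) \<in> smooth_functions M"
  by (cases M) (simp add: smooth_functions_iff Ck_on_const case_prod_unfold)

lemma smooth_functions_mult:
  assumes "f \<in> smooth_functions M" "g \<in> smooth_functions M"
  shows "(\<lambda>x. f x * g x) \<in> smooth_functions M"
  using assms by (cases M) (simp add: smooth_functions_iff Ck_on_mult case_prod_unfold)

lemma subspace_smooth_functions: "subspace (smooth_functions M)"
  unfolding subspace_def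
proof (intro conjI ballI allI)
  show "0 \<in> smooth_functions M"
    using smooth_functions_const[of 0 M] by (simp add: zero_fun_def)
  show "f + g \<in> smooth_functions M" if "f \<in> smooth_functions M" "g \<in> smooth_functions M" for f g
    using that by (cases M) (simp add: smooth_functions_iff Ck_on_add case_prod_unfold)
  show "c *\<^sub>R f \<in> smooth_functions M" if "f \<in> smooth_functions M" for c f
    using smooth_functions_mult[OF smooth_functions_const[of c M] that] by (simp add: scaleR_fun_def)
qed

lemma
  assumes "v \<in> tangent_space M p" "f \<in> smooth_functions M"
  shows tangent_space_add: "g \<in> smooth_functions M \<Longrightarrow> v (f + g) = v f + v g"
    and tangent_space_scale: "v (c *\<^sub>R f) = c * v f"
    and tangent_space_mult:
      "g \<in> smooth_functions M \<Longrightarrow> v (\<lambda>x. f x * g x) = f p * v g + g p * v f"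
  using assms by (auto simp: tangent_space_def linear_on_def)

lemma vector_field_tangent: "X \<in> vector_fields M \<Longrightarrow> X p \<in> tangent_space M p"
  by (simp add: vector_fields_def)

lemma vector_field_smooth:
  "X \<in> vector_fields M \<Longrightarrow> f \<in> smooth_functions M \<Longrightarrow> apply_field X f \<in> smooth_functions M"
  by (simp add: vector_fields_def)

lemma apply_field_add:
  "X \<in> vector_fields M \<Longrightarrow> f \<in> smooth_functions M \<Longrightarrow> g \<in> smooth_functions M \<Longrightarrow>
    apply_field X (f + g) = apply_field X f + apply_field X g"
  by (simp add: apply_field_def fun_eq_iff tangent_space_add[OF vector_field_tangent])

lemma apply_field_scale:
  "X \<in> vector_fields M \<Longrightarrow> f \<in> smooth_functions M \<Longrightarrow> apply_field X (c *\<^sub>R f) = c *\<^sub>R apply_field X f"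
  by (simp add: apply_field_def fun_eq_iff tangent_space_scale[OF vector_field_tangent])

lemma apply_field_zero: "X \<in> vector_fields M \<Longrightarrow> apply_field X 0 = 0"
  using apply_field_scale[OF _ subspace_0[OF subspace_smooth_functions], of X M 0] by simp

lemma apply_field_sum_list:
  assumes X: "X \<in> vector_fields M" and F: "\<And>y. y \<in> set ys \<Longrightarrow> F y \<in> smooth_functions M"
  shows "apply_field X (\<Sum>y\<leftarrow>ys. F y) = (\<Sum>y\<leftarrow>ys. apply_field X (F y))"
  using F
proof (induction ys)
  case (Cons y ys)
  have "(\<Sum>y\<leftarrow>ys. F y) \<in> smooth_functions M"
    using Cons.prems by (intro subspace_sum_list subspace_smooth_functions) simp
  then have "apply_field X (F y + (\<Sum>y\<leftarrow>ys. F y)) = apply_field X (F y) + apply_field X (\<Sum>y\<leftarrow>ys. F y)"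
    using Cons.prems by (intro apply_field_add[OF X]) simp_all
  moreover have "apply_field X (\<Sum>y\<leftarrow>ys. F y) = (\<Sum>y\<leftarrow>ys. apply_field X (F y))"
    using Cons by simp
  ultimately show ?case by (simp only: list.simps sum_list.Cons)
qed (simp add: apply_field_zero[OF X])

lemma apply_field_bracket:
  "f \<in> smooth_functions M \<Longrightarrow> apply_field (field_bracket M X Y) f =
    apply_field X (apply_field Y f) - apply_field Y (apply_field X f)"
  by (simp add: field_bracket_def apply_field_def fun_eq_iff)

text \<open>In the Leibniz rule for \<open>[X, Y]\<close> the mixed terms \<open>Xf \<cdot> Yg + Xg \<cdot> Yf\<close> of the two second-order operators
  cancel.\<close>

lemma field_bracket_vector_field:
  assumes X: "X \<in> vector_fields M" and Y: "Y \<in> vector_fields M"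
  shows "field_bracket M X Y \<in> vector_fields M"
proof -
  note sm = vector_field_smooth[OF X] vector_field_smooth[OF Y]
    subspace_add[OF subspace_smooth_functions] subspace_scale[OF subspace_smooth_functions]
    smooth_functions_mult
  note tX = vector_field_tangent[OF X] and tY = vector_field_tangent[OF Y]
  have leibniz: "Z p (apply_field W (\<lambda>x. f x * g x)) =
      f p * Z p (apply_field W g) + W p g * Z p f + (g p * Z p (apply_field W f) + W p f * Z p g)"
    if Z: "Z \<in> vector_fields M" and W: "W \<in> vector_fields M"
      and f: "f \<in> smooth_functions M" and g: "g \<in> smooth_functions M" for Z W f g p
  proof -
    have W': "apply_field W f \<in> smooth_functions M" "apply_field W g \<in> smooth_functions M"
      using W f g by (simp_all add: vector_field_smooth)
    have "apply_field W (\<lambda>x. f x * g x) = (\<lambda>x. f x * apply_field W g x) + (\<lambda>x. g x * apply_field W f x)"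
      using f g by (simp add: apply_field_def fun_eq_iff tangent_space_mult[OF vector_field_tangent[OF W]])
    then show ?thesis
      using f g W' by (simp add: tangent_space_add[OF vector_field_tangent[OF Z]]
        tangent_space_mult[OF vector_field_tangent[OF Z]] smooth_functions_mult)
        (simp add: apply_field_def)
  qed
  have "field_bracket M X Y p \<in> tangent_space M p" for p
    unfolding tangent_space_def linear_on_def
  proof (intro CollectI conjI ballI allI impI)
    fix f g and c :: real assume f: "f \<in> smooth_functions M" and g: "g \<in> smooth_functions M"
    show "field_bracket M X Y p (f + g) = field_bracket M X Y p f + field_bracket M X Y p g"
      using f g by (simp add: field_bracket_def sm apply_field_add[OF X] apply_field_add[OF Y]
        tangent_space_add[OF tX] tangent_space_add[OF tY])
    show "field_bracket M X Y p (\<lambda>x. f x * g x) =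
        f p * field_bracket M X Y p g + g p * field_bracket M X Y p f"
      using f g leibniz[OF X Y f g, of p] leibniz[OF Y X f g, of p]
      by (simp add: field_bracket_def smooth_functions_mult algebra_simps)
  next
    fix f and c :: real assume f: "f \<in> smooth_functions M"
    show "field_bracket M X Y p (c *\<^sub>R f) = c *\<^sub>R field_bracket M X Y p f"
      using f by (simp add: field_bracket_def sm apply_field_scale[OF X] apply_field_scale[OF Y]
        tangent_space_scale[OF tX] tangent_space_scale[OF tY] algebra_simps)
  qed (simp add: field_bracket_def)
  moreover have "apply_field (field_bracket M X Y) f \<in> smooth_functions M"
    if "f \<in> smooth_functions M" for f
    unfolding apply_field_bracket[OF that]
    using that by (intro subspace_diff[OF subspace_smooth_functions] sm)
  ultimately show ?thesis by (simp add: vector_fields_def)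
qed

lemma forms_smooth:
  assumes "\<alpha> \<in> forms M k"
  shows "\<alpha> Xs \<in> smooth_functions M"
proof (cases "Xs \<in> tuples k (vector_fields M)")
  case False
  then have "\<alpha> Xs = 0" using assms by (simp add: forms_def)
  then show ?thesis by (simp add: subspace_0[OF subspace_smooth_functions])
qed (use assms in \<open>simp add: forms_def\<close>)

lemma forms_off: "\<alpha> \<in> forms M k \<Longrightarrow> Xs \<notin> tuples k (vector_fields M) \<Longrightarrow> \<alpha> Xs = 0"
  by (simp add: forms_def)

lemma forms_update_add:
  "\<alpha> \<in> forms M k \<Longrightarrow> Xs \<in> tuples k (vector_fields M) \<Longrightarrow> i < k \<Longrightarrow>
    X \<in> vector_fields M \<Longrightarrow> Y \<in> vector_fields M \<Longrightarrow> \<alpha> (Xs[i := X + Y]) = \<alpha> (Xs[i := X]) + \<alpha> (Xs[i := Y])"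
  by (simp add: forms_def)

lemma forms_update_times:
  "\<alpha> \<in> forms M k \<Longrightarrow> Xs \<in> tuples k (vector_fields M) \<Longrightarrow> i < k \<Longrightarrow>
    f \<in> smooth_functions M \<Longrightarrow> X \<in> vector_fields M \<Longrightarrow>
    \<alpha> (Xs[i := times_field f X]) = (\<lambda>p. f p * \<alpha> (Xs[i := X]) p)"
  by (simp add: forms_def)

lemma forms_update_scale:
  assumes "\<alpha> \<in> forms M k" "Xs \<in> tuples k (vector_fields M)" "i < k" "X \<in> vector_fields M"
  shows "\<alpha> (Xs[i := c *\<^sub>R X]) = c *\<^sub>R \<alpha> (Xs[i := X])"
proof -
  have "times_field (\<lambda>_. c) X = c *\<^sub>R X"
    by (simp add: times_field_def scaleR_fun_def)
  then show ?thesis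
    using forms_update_times[OF assms(1-3) smooth_functions_const assms(4), of c]
    by (simp add: scaleR_fun_def)
qed

lemma forms_repeat:
  assumes "\<alpha> \<in> forms M k" "Xs \<in> tuples k (vector_fields M)" "i < k" "j < k" "i \<noteq> j" "Xs ! i = Xs ! j"
  shows "\<alpha> Xs = 0"
proof -
  have "\<forall>Xs\<in>tuples k (vector_fields M). \<forall>i<k. \<forall>j<k. i \<noteq> j \<and> Xs ! i = Xs ! j \<longrightarrow> \<alpha> Xs = 0"
    using assms(1) by (simp add: forms_def)
  from this[rule_format, of Xs i j] show ?thesis using assms by simp
qed

lemma subspace_forms: "subspace (forms M k)"
  unfolding subspace_def
proof (intro conjI ballI allI)
  show "0 \<in> forms M k"
    by (simp add: forms_def subspace_0[OF subspace_smooth_functions] zero_fun_def[where 'b = real, symmetric])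
  show "\<alpha> + \<beta> \<in> forms M k" if "\<alpha> \<in> forms M k" "\<beta> \<in> forms M k" for \<alpha> \<beta>
    using that
    by (simp add: forms_def subspace_add[OF subspace_smooth_functions] fun_eq_iff algebra_simps)
  show "c *\<^sub>R \<alpha> \<in> forms M k" if "\<alpha> \<in> forms M k" for c \<alpha>
    using that
    by (simp add: forms_def subspace_scale[OF subspace_smooth_functions] fun_eq_iff algebra_simps)
qed

lemma contract_forms:
  assumes "X \<in> vector_fields M" "\<alpha> \<in> forms M (Suc k)"
  shows "contract X \<alpha> \<in> forms M k"
proof -
  have tup: "X # Xs \<in> tuples (Suc k) (vector_fields M) \<longleftrightarrow> Xs \<in> tuples k (vector_fields M)" for Xs
    using assms(1) by (auto simp: tuples_def)
  show ?thesis
    unfolding forms_def contract_def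
  proof (intro CollectI conjI ballI allI impI)
    fix Xs i assume Xs: "Xs \<in> tuples k (vector_fields M)" and i: "i < k"
    show "\<alpha> (X # Xs[i := times_field f Y]) = (\<lambda>p. f p * \<alpha> (X # Xs[i := Y]) p)"
      if "Y \<in> vector_fields M" "f \<in> smooth_functions M" for Y f
      using forms_update_times[OF assms(2), of "X # Xs" "Suc i" f Y] Xs i that by (simp add: tup)
    show "\<alpha> (X # Xs[i := Y + Z]) = \<alpha> (X # Xs[i := Y]) + \<alpha> (X # Xs[i := Z])"
      if "Y \<in> vector_fields M" "Z \<in> vector_fields M" for Y Z
      using forms_update_add[OF assms(2), of "X # Xs" "Suc i" Y Z] Xs i that by (simp add: tup)
    show "\<alpha> (X # Xs) = 0" if "j < k" "i \<noteq> j \<and> Xs ! i = Xs ! j" for j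
      using forms_repeat[OF assms(2), of "X # Xs" "Suc i" "Suc j"] Xs i that by (simp add: tup)
  qed (simp_all add: forms_smooth[OF assms(2)] forms_off[OF assms(2)] tup)
qed

lemma contract_tuple_apply: "contract_tuple \<zeta> Xs \<omega> Ys = \<omega> (map \<zeta> Xs @ Ys)"
  by (induction Xs arbitrary: \<omega>) (simp_all add: contract_tuple_def contract_def)

lemma contract_tuple_forms:
  assumes "range \<zeta> \<subseteq> vector_fields M" "\<omega> \<in> forms M m" "length Xs \<le> m"
  shows "contract_tuple \<zeta> Xs \<omega> \<in> forms M (m - length Xs)"
  using assms(2,3)
proof (induction Xs arbitrary: \<omega> m)
  case (Cons X Xs)
  then obtain m' where m: "m = Suc m'" by (cases m) auto
  then have "contract (\<zeta> X) \<omega> \<in> forms M m'"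
    using contract_forms[of "\<zeta> X" M \<omega> m'] Cons.prems assms(1) by auto
  then show ?case
    using Cons.IH[of "contract (\<zeta> X) \<omega>" m'] Cons.prems m by (simp add: contract_tuple_def)
qed (simp add: contract_tuple_def)

text \<open>This is \<open>g_cochain \<omega> \<zeta> k\<close> up to sign.\<close>

definition contraction_cochain :: "'a form \<Rightarrow> ('g \<Rightarrow> 'a vector_field) \<Rightarrow> nat \<Rightarrow> 'g list \<Rightarrow> 'a form"
  where "contraction_cochain \<omega> \<zeta> k = (\<lambda>Xs. if length Xs = k then contract_tuple \<zeta> Xs \<omega> else 0)"

lemma contraction_cochain_multilinear_alternating:
  assumes \<zeta>: "linear \<zeta>" "range \<zeta> \<subseteq> vector_fields M" and \<omega>: "\<omega> \<in> forms M m" and k: "k \<le> m"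
  shows "contraction_cochain \<omega> \<zeta> k \<in> multilinear_alternating k"
proof (rule multilinear_alternatingI)
  let ?V = "vector_fields M"
  have \<zeta>V: "\<zeta> X \<in> ?V" for X using \<zeta>(2) by auto
  fix Xs :: "'a list" and i assume i: "i < length Xs"
  show "linear (\<lambda>X. contraction_cochain \<omega> \<zeta> k (Xs[i := X]))"
  proof (cases "length Xs = k")
    case False
    then show ?thesis
      using module_hom_zero by (simp add: contraction_cochain_def flip: zero_fun_def)
  next
    case True
    have upd: "map \<zeta> (Xs[i := X]) @ Ys = (map \<zeta> Xs @ Ys)[i := \<zeta> X]" for X Ys
      using i by (simp add: map_update list_update_append)
    have "\<omega> (map \<zeta> (Xs[i := X + Y]) @ Ys) = \<omega> (map \<zeta> (Xs[i := X]) @ Ys) + \<omega> (map \<zeta> (Xs[i := Y]) @ Ys)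
      \<and> \<omega> (map \<zeta> (Xs[i := c *\<^sub>R X]) @ Ys) = c *\<^sub>R \<omega> (map \<zeta> (Xs[i := X]) @ Ys)" for X Y c Ys
    proof (cases "map \<zeta> Xs @ Ys \<in> tuples m ?V")
      case T: True
      show ?thesis
        using i True k \<zeta>V unfolding upd linear_add[OF \<zeta>(1)] linear_scale[OF \<zeta>(1)]
        by (simp add: forms_update_add[OF \<omega> T] forms_update_scale[OF \<omega> T])
    next
      case False
      then have "map \<zeta> (Xs[i := Z]) @ Ys \<notin> tuples m ?V" for Z
        using \<zeta>V by (auto simp: tuples_def)
      then show ?thesis by (simp add: forms_off[OF \<omega>])
    qed
    then show ?thesis
      using True
      by (intro linearI ext) (simp_all add: contraction_cochain_def contract_tuple_apply)
  qed
next
  fix Xs :: "'a list" and i j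
  assume ij: "i < length Xs" "j < length Xs" "i \<noteq> j" "Xs ! i = Xs ! j"
  show "contraction_cochain \<omega> \<zeta> k Xs = 0"
  proof (cases "length Xs = k")
    case True
    have "\<omega> (map \<zeta> Xs @ Ys) = 0" for Ys
    proof (cases "map \<zeta> Xs @ Ys \<in> tuples m (vector_fields M)")
      case T: True
      show ?thesis
        using forms_repeat[OF \<omega> T, of i j] ij True k by (simp add: nth_append)
    qed (simp add: forms_off[OF \<omega>])
    then show ?thesis by (simp add: contraction_cochain_def contract_tuple_apply fun_eq_iff)
  qed (simp add: contraction_cochain_def)
qed (simp add: contraction_cochain_def)

lemma ext_deriv_zero_form:
  assumes "h \<in> smooth_functions M"
  shows "ext_deriv M (zero_form h) Xs =
    (if length Xs = 1 \<and> set Xs \<subseteq> vector_fields M then apply_field (Xs ! 0) h else 0)"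
proof (cases "set Xs \<subseteq> vector_fields M")
  case V: True
  have brackets: "zero_form h (Y # Ys) = 0" for Y Ys
    by (simp add: zero_form_def)
  consider "Xs = []" | Y where "Xs = [Y]" | Y Z Zs where "Xs = Y # Z # Zs"
    by (cases Xs rule: remdups_adj.cases) auto
  then show ?thesis
  proof cases
    case 2
    then show ?thesis using V
      by (simp add: ext_deriv_def brackets nths_Cons) (simp add: zero_form_def)
  next
    case 3
    have "zero_form h (nths Xs (- {i})) = 0" for i
    proof -
      have "set (nths Xs (- {i})) \<noteq> {}"
        unfolding set_nths using 3 by (cases i) (auto intro: exI[of _ 0] exI[of _ 1])
      then show ?thesis by (auto simp: zero_form_def)
    qed
    then have "ext_deriv M (zero_form h) Xs = (\<Sum>i<length Xs. (-1) ^ i *\<^sub>R apply_field (Xs ! i) 0)"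
      using V by (simp add: ext_deriv_def brackets)
    also have "\<dots> = 0"
      using V apply_field_zero[of _ M] by (intro sum.neutral) (auto simp: subset_iff)
    finally show ?thesis using 3 by simp
  qed (simp add: ext_deriv_def)
qed (auto simp: ext_deriv_def)

lemma ext_deriv_zero_form_add:
  assumes "h \<in> smooth_functions M" "h' \<in> smooth_functions M"
  shows "ext_deriv M (zero_form (h + h')) = ext_deriv M (zero_form h) + ext_deriv M (zero_form h')"
proof
  fix Xs
  show "ext_deriv M (zero_form (h + h')) Xs = (ext_deriv M (zero_form h) + ext_deriv M (zero_form h')) Xs"
    using apply_field_add[OF _ assms, of "Xs ! 0"] assms
    by (cases Xs) (auto simp: ext_deriv_zero_form subspace_add[OF subspace_smooth_functions])
qed

lemma ext_deriv_zero_form_scale: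
  assumes "h \<in> smooth_functions M"
  shows "ext_deriv M (zero_form (c *\<^sub>R h)) = c *\<^sub>R ext_deriv M (zero_form h)"
proof
  fix Xs
  show "ext_deriv M (zero_form (c *\<^sub>R h)) Xs = (c *\<^sub>R ext_deriv M (zero_form h)) Xs"
    using apply_field_scale[OF _ assms, of "Xs ! 0" c] assms
    by (cases Xs) (auto simp: ext_deriv_zero_form subspace_scale[OF subspace_smooth_functions])
qed

lemma ext_deriv_zero_form_zero: "ext_deriv M (zero_form 0) = 0"
  using ext_deriv_zero_form_scale[OF subspace_0[OF subspace_smooth_functions], of M 0] by simp

lemma zero_form_eq:
  assumes "\<beta> \<in> forms M 0"
  shows "\<beta> = zero_form (\<beta> [])"
  using assms by (auto simp: forms_def tuples_def zero_form_def fun_eq_iff)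

lemma lie_deriv_zero_form:
  assumes "V \<in> vector_fields M"
  shows "lie_deriv M V (zero_form h) = zero_form (apply_field V h)"
proof
  fix Xs
  show "lie_deriv M V (zero_form h) Xs = zero_form (apply_field V h) Xs"
  proof (cases "Xs = []")
    case False
    then have "zero_form h (Xs[i := Z]) = 0" for i Z
      by (simp add: zero_form_def)
    then show ?thesis
      using False apply_field_zero[OF assms] by (simp add: lie_deriv_def zero_form_def)
  qed (simp add: lie_deriv_def zero_form_def)
qed


section \<open>Consequences of the vanishing of the classes\<close>

lemma exact_ext_forms_subset:
  assumes "lie_algebra br"
  shows "exact_ext_forms br k \<subseteq> ext_forms k"
  using ce_diff_multilinear_alternating[OF assms] subspace_0[OF subspace_multilinear_alternating]
  by (cases k) (auto simp: exact_ext_forms_def ext_forms_def)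

lemma zero_exact_ext_forms: "0 \<in> exact_ext_forms br k"
proof (cases k)
  case (Suc l)
  have "ce_diff br 0 = 0"
    by (simp add: ce_diff_def fun_eq_iff)
  then show ?thesis
    using subspace_0[OF subspace_multilinear_alternating, of l]
    by (auto simp: exact_ext_forms_def ext_forms_def Suc intro!: image_eqI[of _ _ 0])
qed (simp add: exact_ext_forms_def)

lemma zero_exact_forms: "0 \<in> exact_forms M k"
proof (cases k)
  case (Suc l)
  have "apply_field (Xs ! i) 0 = 0" if "set Xs \<subseteq> vector_fields M" "i < length Xs" for Xs i
    using that by (intro apply_field_zero[of _ M]) auto
  then have "ext_deriv M 0 = 0"
    by (simp add: ext_deriv_def fun_eq_iff sum_apply)
  then show ?thesis
    using subspace_0[OF subspace_forms, of M l]
    by (auto simp: exact_forms_def Suc intro!: image_eqI[of _ _ 0])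
qed (simp add: exact_forms_def)

text \<open>The cochain inside \<open>h_class\<close> enters through a chosen tensor presentation, which exists by
  \<open>alternating_map_presentation\<close>; passing from the class back to the cochain is
  \<open>quotient_tensor_eq_zeroD\<close> for the bilinear map \<open>(f, \<alpha>) \<mapsto> f \<otimes> \<alpha>\<close>.\<close>

lemma h_class_zeroD:
  fixes br :: "'g::real_vector \<Rightarrow> 'g \<Rightarrow> 'g" and B :: "'g set"
  assumes br: "lie_algebra br" and B: "finite B" "span B = UNIV"
    and \<zeta>: "linear \<zeta>" "range \<zeta> \<subseteq> vector_fields M" and \<omega>: "\<omega> \<in> forms M (n + 1)"
    and k: "k \<le> n + 1"
    and zero: "h_class M n \<omega> br \<zeta> k = mixed_class M br k (n + 1 - k) 0"
  shows "contraction_cochain \<omega> \<zeta> k \<in> span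
    ({(\<lambda>Xs. f Xs *\<^sub>R \<alpha>) | f \<alpha>. f \<in> exact_ext_forms br k \<and> \<alpha> \<in> forms M (n + 1 - k)} \<union>
     {(\<lambda>Xs. f Xs *\<^sub>R \<alpha>) | f \<alpha>. f \<in> ext_forms k \<and> \<alpha> \<in> exact_forms M (n + 1 - k)})"
proof -
  let ?l = "n + 1 - k" and ?g = "g_cochain \<omega> \<zeta> k"
  define h :: "('g list \<Rightarrow> real) \<Rightarrow> 'a form \<Rightarrow> 'g list \<Rightarrow> 'a form" where "h f \<alpha> = (\<lambda>Xs. f Xs *\<^sub>R \<alpha>)" for f \<alpha>
  have h: "bilinear h"
    unfolding bilinear_def h_def
    by (auto intro!: linearI simp: fun_eq_iff algebra_simps)
  \<comment> \<open>Since \<open>s * s = 1\<close>, scaling by \<open>s\<close> again recovers the cochain without its sign.\<close>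
  define s :: real where "s = - ((-1) ^ (k * (k + 1) div 2))"
  have ss: "s * s = 1"
    by (simp add: s_def flip: power_mult_distrib)
  have g: "?g = s *\<^sub>R contraction_cochain \<omega> \<zeta> k"
    by (intro ext) (simp add: g_cochain_def contraction_cochain_def s_def)
  have "?g \<in> multilinear_alternating k"
    unfolding g using contraction_cochain_multilinear_alternating[OF \<zeta> \<omega> k]
    by (rule subspace_scale[OF subspace_multilinear_alternating])
  moreover have "range ?g \<subseteq> forms M ?l"
  proof -
    have "contraction_cochain \<omega> \<zeta> k Xs \<in> forms M ?l" for Xs
      using contract_tuple_forms[OF \<zeta>(2) \<omega>, of Xs] k subspace_0[OF subspace_forms, of M ?l]
      by (auto simp: contraction_cochain_def)
    then show ?thesis unfolding g by (auto intro: subspace_scale[OF subspace_forms])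
  qed
  ultimately have "\<exists>ts. set ts \<subseteq> ext_forms k \<times> forms M ?l \<and> ?g = (\<lambda>Xs. \<Sum>(f, \<alpha>)\<leftarrow>ts. f Xs *\<^sub>R \<alpha>)"
    using alternating_map_presentation[OF _ B, of ?g k] by blast
  from someI_ex[OF this] have ts: "set (tensor_terms M k ?l ?g) \<subseteq> ext_forms k \<times> forms M ?l"
    and g_ts: "?g = (\<lambda>Xs. \<Sum>(f, \<alpha>)\<leftarrow>tensor_terms M k ?l ?g. f Xs *\<^sub>R \<alpha>)"
    by (simp_all add: tensor_terms_def)
  have "?g = (\<Sum>(f, \<alpha>)\<leftarrow>tensor_terms M k ?l ?g. h f \<alpha>)"
  proof
    fix Xs
    show "?g Xs = (\<Sum>(f, \<alpha>)\<leftarrow>tensor_terms M k ?l ?g. h f \<alpha>) Xs"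
      by (subst g_ts) (simp add: case_prod_unfold sum_list_apply h_def)
  qed
  also have "\<dots> \<in> span ({h f \<alpha> | f \<alpha>. f \<in> exact_ext_forms br k \<and> \<alpha> \<in> forms M ?l} \<union>
      {h f \<alpha> | f \<alpha>. f \<in> ext_forms k \<and> \<alpha> \<in> exact_forms M ?l})"
    using zero unfolding h_class_def mixed_class_def ext_forms_def
    by (intro quotient_tensor_eq_zeroD[OF h subspace_multilinear_alternating subspace_forms
        exact_ext_forms_subset[OF br, unfolded ext_forms_def] zero_exact_ext_forms zero_exact_forms
        ts[unfolded ext_forms_def]])
  finally have "s *\<^sub>R ?g \<in> span ({h f \<alpha> | f \<alpha>. f \<in> exact_ext_forms br k \<and> \<alpha> \<in> forms M ?l} \<union>
      {h f \<alpha> | f \<alpha>. f \<in> ext_forms k \<and> \<alpha> \<in> exact_forms M ?l})"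
    by (rule span_scale)
  moreover have "s *\<^sub>R ?g = contraction_cochain \<omega> \<zeta> k"
    by (simp add: g ss)
  ultimately show ?thesis by (simp add: h_def)
qed

text \<open>The existence of \<open>v\<close> is inherited by linear combinations of cochains, so it suffices to treat the
  generators: for \<open>\<delta>f \<otimes> \<alpha>\<close> the sum is \<open>p(\<delta>f) \<alpha> = 0\<close>, and for \<open>f \<otimes> d\<beta>\<close> the function \<open>v(p) = p(f) \<beta>\<close> works. The
  statement is for all presentations of \<open>p\<close>, because it is applied to several of them.\<close>

lemma primitive_on_lie_kernel:
  fixes G :: "'g::real_vector list \<Rightarrow> 'a::{t2_space, second_countable_topology} form"
  assumes br: "lie_algebra br" and n: "n \<ge> 1"
    and G: "G \<in> span
      ({(\<lambda>Xs. f Xs *\<^sub>R \<alpha>) | f \<alpha>. f \<in> exact_ext_forms br n \<and> \<alpha> \<in> forms M 1} \<union>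
       {(\<lambda>Xs. f Xs *\<^sub>R \<alpha>) | f \<alpha>. f \<in> ext_forms n \<and> \<alpha> \<in> exact_forms M 1})"
  shows "\<exists>v. linear v \<and> range v \<subseteq> smooth_functions M \<and>
    (\<forall>ts. set ts \<subseteq> tuples n UNIV \<longrightarrow> (\<Sum>Xs\<leftarrow>ts. wedge Xs) \<in> lie_kernel br n \<longrightarrow>
      (\<Sum>Xs\<leftarrow>ts. G Xs) = ext_deriv M (zero_form (v (\<Sum>Xs\<leftarrow>ts. wedge Xs))))"
    (is "\<exists>v. ?P v G")
proof -
  have "{(\<lambda>Xs. f Xs *\<^sub>R \<alpha>) | f \<alpha>. f \<in> exact_ext_forms br n \<and> \<alpha> \<in> forms M 1} \<subseteq> {G. \<exists>v. ?P v G}"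
  proof clarify
    fix f :: "'g list \<Rightarrow> real" and \<alpha> :: "'a form"
    assume "f \<in> exact_ext_forms br n"
    then obtain f' where f': "f = ce_diff br f'" "f' \<in> ext_forms (n - 1)"
      using n by (auto simp: exact_ext_forms_def split: nat.splits)
    have f: "f \<in> ext_forms n"
      using exact_ext_forms_subset[OF br] \<open>f \<in> exact_ext_forms br n\<close> by blast
    have vanish: "(\<Sum>Xs\<leftarrow>ts. f Xs *\<^sub>R \<alpha>) = 0"
      if "set ts \<subseteq> tuples n UNIV" "(\<Sum>Xs\<leftarrow>ts. wedge Xs) \<in> lie_kernel br n" for ts
    proof -
      have "(\<Sum>Xs\<leftarrow>ts. f Xs *\<^sub>R \<alpha>) = (\<Sum>Xs\<leftarrow>ts. f Xs) *\<^sub>R \<alpha>"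
        by (rule sum_list_scaleR_left)
      also have "(\<Sum>Xs\<leftarrow>ts. f Xs) = 0"
        using lie_kernel_exact_eval[OF that(2) f'(2)] wedge_sum_eval[OF that(1) f] f'(1) by simp
      finally show ?thesis unfolding scaleR_zero_left .
    qed
    have "?P (\<lambda>_. 0) (\<lambda>Xs. f Xs *\<^sub>R \<alpha>)"
    proof (intro conjI allI impI image_subsetI module_hom_zero)
      show "0 \<in> smooth_functions M"
        by (rule subspace_0[OF subspace_smooth_functions])
    qed (simp only: vanish ext_deriv_zero_form_zero)
    then show "\<exists>v. ?P v (\<lambda>Xs. f Xs *\<^sub>R \<alpha>)" by blast
  qed
  moreover have "{(\<lambda>Xs. f Xs *\<^sub>R \<alpha>) | f \<alpha>. f \<in> ext_forms n \<and> \<alpha> \<in> exact_forms M 1} \<subseteq> {G. \<exists>v. ?P v G}"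
  proof clarify
    fix f :: "'g list \<Rightarrow> real" and \<alpha> :: "'a form"
    assume f: "f \<in> ext_forms n" and "\<alpha> \<in> exact_forms M 1"
    then obtain \<beta> where \<beta>: "\<beta> \<in> forms M 0" and \<alpha>: "\<alpha> = ext_deriv M \<beta>"
      by (auto simp: exact_forms_def)
    have sm: "\<beta> [] \<in> smooth_functions M" by (rule forms_smooth[OF \<beta>])
    have eval: "(\<Sum>Xs\<leftarrow>ts. f Xs *\<^sub>R \<alpha>) = ext_deriv M (zero_form ((\<Sum>Xs\<leftarrow>ts. wedge Xs) f *\<^sub>R \<beta> []))"
      if "set ts \<subseteq> tuples n UNIV" for ts
    proof -
      have "(\<Sum>Xs\<leftarrow>ts. f Xs *\<^sub>R \<alpha>) = (\<Sum>Xs\<leftarrow>ts. wedge Xs) f *\<^sub>R ext_deriv M (zero_form (\<beta> []))"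
        unfolding wedge_sum_eval[OF that f] zero_form_eq[OF \<beta>, symmetric] \<alpha>
        by (rule sum_list_scaleR_left)
      then show ?thesis by (simp only: ext_deriv_zero_form_scale[OF sm])
    qed
    have "?P (\<lambda>p. p f *\<^sub>R \<beta> []) (\<lambda>Xs. f Xs *\<^sub>R \<alpha>)"
    proof (intro conjI allI impI image_subsetI eval)
      show "linear (\<lambda>p :: 'g multivector. p f *\<^sub>R \<beta> [])"
        by (rule linearI) (simp_all add: scaleR_add_left)
      show "p f *\<^sub>R \<beta> [] \<in> smooth_functions M" for p :: "'g multivector"
        by (rule subspace_scale[OF subspace_smooth_functions sm])
    qed
    then show "\<exists>v. ?P v (\<lambda>Xs. f Xs *\<^sub>R \<alpha>)" by blast
  qed
  moreover have "subspace {G. \<exists>v. ?P v G}"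
    unfolding subspace_def
  proof (intro conjI ballI allI)
    have "sum_list (map (0 :: 'g list \<Rightarrow> 'a form) ts) = 0" for ts
      by (induction ts) simp_all
    then show "0 \<in> {G. \<exists>v. ?P v G}"
      by (auto intro!: exI[of _ "\<lambda>_. 0"] linearI
        simp: ext_deriv_zero_form_zero subspace_0[OF subspace_smooth_functions])
  next
    fix G H assume "G \<in> {G. \<exists>v. ?P v G}" "H \<in> {G. \<exists>v. ?P v G}"
    then obtain v w where v: "?P v G" and w: "?P w H" by auto
    then have sm: "v p \<in> smooth_functions M" "w p \<in> smooth_functions M" for p by auto
    have "?P (\<lambda>p. v p + w p) (G + H)"
    proof (intro conjI allI impI image_subsetI)
      show "linear (\<lambda>p. v p + w p)"
        using v w by (intro linear_compose_add) simp_all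
      show "v p + w p \<in> smooth_functions M" for p
        using sm by (intro subspace_add[OF subspace_smooth_functions])
      fix ts assume ts: "set ts \<subseteq> tuples n UNIV" "(\<Sum>Xs\<leftarrow>ts. wedge Xs) \<in> lie_kernel br n"
      have "(\<Sum>Xs\<leftarrow>ts. (G + H) Xs) = (\<Sum>Xs\<leftarrow>ts. G Xs) + (\<Sum>Xs\<leftarrow>ts. H Xs)"
        by (simp only: plus_fun_apply sum_list_addf)
      then show "(\<Sum>Xs\<leftarrow>ts. (G + H) Xs) =
          ext_deriv M (zero_form (v (\<Sum>Xs\<leftarrow>ts. wedge Xs) + w (\<Sum>Xs\<leftarrow>ts. wedge Xs)))"
        unfolding ext_deriv_zero_form_add[OF sm] using v w ts by metis
    qed
    then show "G + H \<in> {G. \<exists>v. ?P v G}" by blast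
  next
    fix G and c :: real assume "G \<in> {G. \<exists>v. ?P v G}"
    then obtain v where v: "?P v G" by auto
    then have sm: "v p \<in> smooth_functions M" for p by auto
    have "?P (\<lambda>p. c *\<^sub>R v p) (c *\<^sub>R G)"
    proof (intro conjI allI impI image_subsetI)
      show "linear (\<lambda>p. c *\<^sub>R v p)"
        using v by (intro linear_compose_scale_right) simp
      show "c *\<^sub>R v p \<in> smooth_functions M" for p
        by (intro subspace_scale[OF subspace_smooth_functions] sm)
      fix ts assume ts: "set ts \<subseteq> tuples n UNIV" "(\<Sum>Xs\<leftarrow>ts. wedge Xs) \<in> lie_kernel br n"
      have "(\<Sum>Xs\<leftarrow>ts. (c *\<^sub>R G) Xs) = c *\<^sub>R (\<Sum>Xs\<leftarrow>ts. G Xs)"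
        by (simp only: scaleR_fun_apply scaleR_sum_list)
      then show "(\<Sum>Xs\<leftarrow>ts. (c *\<^sub>R G) Xs) = ext_deriv M (zero_form (c *\<^sub>R v (\<Sum>Xs\<leftarrow>ts. wedge Xs)))"
        unfolding ext_deriv_zero_form_scale[OF sm] using v ts by metis
    qed
    then show "c *\<^sub>R G \<in> {G. \<exists>v. ?P v G}" by blast
  qed
  ultimately have "span
      ({(\<lambda>Xs. f Xs *\<^sub>R \<alpha>) | f \<alpha>. f \<in> exact_ext_forms br n \<and> \<alpha> \<in> forms M 1} \<union>
       {(\<lambda>Xs. f Xs *\<^sub>R \<alpha>) | f \<alpha>. f \<in> ext_forms n \<and> \<alpha> \<in> exact_forms M 1}) \<subseteq> {G. \<exists>v. ?P v G}"
    by (intro span_minimal Un_least)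
  then show ?thesis using G by auto
qed

text \<open>Again by linearity in \<open>G\<close>. For a generator \<open>\<delta>f \<otimes> \<alpha>\<close>, Cartan's formula turns the sum of the
  \<open>\<delta>f (X\<^sub>1, \<dots>, X\<^sub>n, X)\<close> into \<open>\<plusminus> ((ad\<^sub>X p)(f) + p(\<delta>\<iota>\<^sub>Xf))\<close>, whose second term vanishes on the Lie kernel. The
  other generators are zero, since \<open>0\<close> is the only exact \<open>0\<close>-form.\<close>

lemma potential_on_ad_terms:
  fixes G :: "'g::real_vector list \<Rightarrow> 'a::{t2_space, second_countable_topology} form"
  assumes br: "lie_algebra br" and n: "n \<ge> 1"
    and G: "G \<in> span
      ({(\<lambda>Xs. f Xs *\<^sub>R \<alpha>) | f \<alpha>. f \<in> exact_ext_forms br (n + 1) \<and> \<alpha> \<in> forms M 0} \<union>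
       {(\<lambda>Xs. f Xs *\<^sub>R \<alpha>) | f \<alpha>. f \<in> ext_forms (n + 1) \<and> \<alpha> \<in> exact_forms M 0})"
  shows "\<exists>w. linear w \<and> range w \<subseteq> smooth_functions M \<and>
    (\<forall>X ts. set ts \<subseteq> tuples n UNIV \<longrightarrow> (\<Sum>Xs\<leftarrow>ts. wedge Xs) \<in> lie_kernel br n \<longrightarrow>
      (\<Sum>Xs\<leftarrow>ts. G (Xs @ [X]) []) = w (\<Sum>Xs\<leftarrow>ad_terms br X ts. wedge Xs))"
    (is "\<exists>w. ?P w G")
proof -
  have "{(\<lambda>Xs. f Xs *\<^sub>R \<alpha>) | f \<alpha>. f \<in> exact_ext_forms br (n + 1) \<and> \<alpha> \<in> forms M 0} \<subseteq> {G. \<exists>w. ?P w G}"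
  proof clarify
    fix f :: "'g list \<Rightarrow> real" and \<alpha> :: "'a form"
    assume "f \<in> exact_ext_forms br (n + 1)" and \<alpha>: "\<alpha> \<in> forms M 0"
    then obtain f' where f: "f = ce_diff br f'" and f': "f' \<in> ext_forms n"
      by (auto simp: exact_ext_forms_def)
    let ?s = "(-1) ^ n :: real"
    have eval: "(\<Sum>Xs\<leftarrow>ts. f (Xs @ [X])) = - ?s * (\<Sum>Xs\<leftarrow>ad_terms br X ts. wedge Xs) f'"
      if ts: "set ts \<subseteq> tuples n UNIV" and p: "(\<Sum>Xs\<leftarrow>ts. wedge Xs) \<in> lie_kernel br n" for X ts
    proof -
      have int: "contract_first X f' \<in> ext_forms (n - 1)"
        using f' contract_first_multilinear_alternating by (auto simp: ext_forms_def)
      then have dint: "ce_diff br (contract_first X f') \<in> ext_forms n"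
        using ce_diff_multilinear_alternating[OF br, of "contract_first X f'" "n - 1"] n
        by (simp add: ext_forms_def)
      have "f (Xs @ [X]) = - ?s * coad br X f' Xs - ?s * ce_diff br (contract_first X f') Xs"
        if "Xs \<in> set ts" for Xs
      proof -
        have "length Xs = n" using that ts by (auto simp: tuples_def)
        then have "f (Xs @ [X]) = ?s * f (X # Xs)"
          using move_last_to_front[OF ce_diff_multilinear_alternating[OF br], of f' n Xs X] f'
          by (simp add: f ext_forms_def)
        also have "f (X # Xs) = - coad br X f' Xs - ce_diff br (contract_first X f') Xs"
          unfolding f using f' by (intro ce_diff_Cons) (simp add: ext_forms_def)
        finally show ?thesis by (simp add: algebra_simps)
      qed
      then have "(\<Sum>Xs\<leftarrow>ts. f (Xs @ [X])) =
          (\<Sum>Xs\<leftarrow>ts. - ?s * coad br X f' Xs - ?s * ce_diff br (contract_first X f') Xs)"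
        by (intro arg_cong[where f = sum_list] map_cong) auto
      also have "\<dots> = - ?s * (\<Sum>Xs\<leftarrow>ts. coad br X f' Xs)
          - ?s * (\<Sum>Xs\<leftarrow>ts. ce_diff br (contract_first X f') Xs)"
        by (simp only: sum_list_subtractf sum_list_const_mult)
      also have "(\<Sum>Xs\<leftarrow>ts. ce_diff br (contract_first X f') Xs) = 0"
        using lie_kernel_exact_eval[OF p int] wedge_sum_eval[OF ts dint] by simp
      also have "(\<Sum>Xs\<leftarrow>ts. coad br X f' Xs) = (\<Sum>Xs\<leftarrow>ad_terms br X ts. wedge Xs) f'"
        unfolding wedge_sum_eval[OF ad_terms_tuples[OF ts] f'] by (rule sum_list_ad_terms[symmetric])
      finally show ?thesis by simp
    qed
    let ?w = "\<lambda>q. (- ?s * q f') *\<^sub>R \<alpha> []"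
    have "?P ?w (\<lambda>Xs. f Xs *\<^sub>R \<alpha>)"
    proof (intro conjI allI impI image_subsetI)
      show "linear ?w"
        by (rule linearI) (simp_all add: scaleR_diff_left distrib_left mult.left_commute)
      show "?w q \<in> smooth_functions M" for q
        by (intro subspace_scale[OF subspace_smooth_functions] forms_smooth[OF \<alpha>])
      show "(\<Sum>Xs\<leftarrow>ts. (f (Xs @ [X]) *\<^sub>R \<alpha>) []) = ?w (\<Sum>Xs\<leftarrow>ad_terms br X ts. wedge Xs)"
        if "set ts \<subseteq> tuples n UNIV" "(\<Sum>Xs\<leftarrow>ts. wedge Xs) \<in> lie_kernel br n" for X ts
        by (simp only: scaleR_fun_apply sum_list_scaleR_left eval[OF that])
    qed
    then show "\<exists>w. ?P w (\<lambda>Xs. f Xs *\<^sub>R \<alpha>)" by blast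
  qed
  moreover have "{(\<lambda>Xs. f Xs *\<^sub>R \<alpha>) | f \<alpha>. f \<in> ext_forms (n + 1) \<and> \<alpha> \<in> exact_forms M 0} \<subseteq> {G. \<exists>w. ?P w G}"
  proof clarify
    fix f :: "'g list \<Rightarrow> real" and \<alpha> :: "'a form"
    assume "\<alpha> \<in> exact_forms M 0"
    then have zero: "(f Xs *\<^sub>R \<alpha>) [] = 0" for Xs by (simp add: exact_forms_def)
    have "?P (\<lambda>_. 0) (\<lambda>Xs. f Xs *\<^sub>R \<alpha>)"
    proof (intro conjI allI impI image_subsetI module_hom_zero)
      show "0 \<in> smooth_functions M"
        by (rule subspace_0[OF subspace_smooth_functions])
    qed (simp only: zero sum_list_0)
    then show "\<exists>w. ?P w (\<lambda>Xs. f Xs *\<^sub>R \<alpha>)" by blast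
  qed
  moreover have "subspace {G. \<exists>w. ?P w G}"
    unfolding subspace_def
  proof (intro conjI ballI allI)
    show "0 \<in> {G. \<exists>w. ?P w G}"
      by (auto intro!: exI[of _ "\<lambda>_. 0"] linearI simp: subspace_0[OF subspace_smooth_functions])
  next
    fix G H assume "G \<in> {G. \<exists>w. ?P w G}" "H \<in> {G. \<exists>w. ?P w G}"
    then obtain v w where v: "?P v G" and w: "?P w H" by auto
    have "?P (\<lambda>q. v q + w q) (G + H)"
    proof (intro conjI allI impI image_subsetI)
      show "linear (\<lambda>q. v q + w q)"
        using v w by (intro linear_compose_add) simp_all
      show "v q + w q \<in> smooth_functions M" for q
        using v w by (intro subspace_add[OF subspace_smooth_functions]) auto
      fix X ts assume ts: "set ts \<subseteq> tuples n UNIV" "(\<Sum>Xs\<leftarrow>ts. wedge Xs) \<in> lie_kernel br n"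
      have "(\<Sum>Xs\<leftarrow>ts. (G + H) (Xs @ [X]) []) = (\<Sum>Xs\<leftarrow>ts. G (Xs @ [X]) [] + H (Xs @ [X]) [])"
        by simp
      also have "\<dots> = (\<Sum>Xs\<leftarrow>ts. G (Xs @ [X]) []) + (\<Sum>Xs\<leftarrow>ts. H (Xs @ [X]) [])"
        by (rule sum_list_addf)
      finally show "(\<Sum>Xs\<leftarrow>ts. (G + H) (Xs @ [X]) []) =
          v (\<Sum>Xs\<leftarrow>ad_terms br X ts. wedge Xs) + w (\<Sum>Xs\<leftarrow>ad_terms br X ts. wedge Xs)"
        using v w ts by metis
    qed
    then show "G + H \<in> {G. \<exists>w. ?P w G}" by blast
  next
    fix G and c :: real assume "G \<in> {G. \<exists>w. ?P w G}"
    then obtain w where w: "?P w G" by auto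
    have "?P (\<lambda>q. c *\<^sub>R w q) (c *\<^sub>R G)"
    proof (intro conjI allI impI image_subsetI)
      show "linear (\<lambda>q. c *\<^sub>R w q)"
        using w by (intro linear_compose_scale_right) simp
      show "c *\<^sub>R w q \<in> smooth_functions M" for q
        using w by (intro subspace_scale[OF subspace_smooth_functions]) auto
      fix X ts assume ts: "set ts \<subseteq> tuples n UNIV" "(\<Sum>Xs\<leftarrow>ts. wedge Xs) \<in> lie_kernel br n"
      have "(\<Sum>Xs\<leftarrow>ts. (c *\<^sub>R G) (Xs @ [X]) []) = c *\<^sub>R (\<Sum>Xs\<leftarrow>ts. G (Xs @ [X]) [])"
        by (simp only: scaleR_fun_apply scaleR_sum_list)
      then show "(\<Sum>Xs\<leftarrow>ts. (c *\<^sub>R G) (Xs @ [X]) []) = c *\<^sub>R w (\<Sum>Xs\<leftarrow>ad_terms br X ts. wedge Xs)"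
        using w ts by metis
    qed
    then show "c *\<^sub>R G \<in> {G. \<exists>w. ?P w G}" by blast
  qed
  ultimately have "span
      ({(\<lambda>Xs. f Xs *\<^sub>R \<alpha>) | f \<alpha>. f \<in> exact_ext_forms br (n + 1) \<and> \<alpha> \<in> forms M 0} \<union>
       {(\<lambda>Xs. f Xs *\<^sub>R \<alpha>) | f \<alpha>. f \<in> ext_forms (n + 1) \<and> \<alpha> \<in> exact_forms M 0}) \<subseteq> {G. \<exists>w. ?P w G}"
    by (intro span_minimal Un_least)
  then show ?thesis using G by auto
qed

section \<open>The multi-moment map\<close>

text \<open>If \<open>du = \<iota>\<^sub>p\<omega>\<close>, then \<open>d(\<zeta>(X)u) = L\<^bsub>\<zeta>(X)\<^esub>(\<iota>\<^sub>p\<omega>)\<close>, which is the contraction with \<open>ad\<^sub>X p\<close> because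
  \<open>\<zeta>(X)\<close> preserves \<open>\<omega>\<close>. Evaluated on \<open>Y\<close>: invariance of \<open>\<omega>\<close> gives \<open>\<zeta>(X)(Yu)\<close>, and the term in which
  \<open>\<zeta>(X)\<close> acts on \<open>Y\<close> is \<open>[\<zeta>(X), Y]u\<close>.\<close>

lemma derivative_along_preserving_action:
  assumes \<zeta>: "range \<zeta> \<subseteq> preserving_fields M \<omega>"
    and hom: "\<And>X Y. \<zeta> (br X Y) = field_bracket M (\<zeta> X) (\<zeta> Y)"
    and \<omega>: "\<omega> \<in> forms M m"
    and u: "u \<in> smooth_functions M"
    and du: "\<And>Y. Y \<in> vector_fields M \<Longrightarrow> apply_field Y u = (\<Sum>Xs\<leftarrow>ts. \<omega> (map \<zeta> Xs @ [Y]))"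
    and Y: "Y \<in> vector_fields M"
  shows "apply_field Y (apply_field (\<zeta> X) u) = (\<Sum>Xs\<leftarrow>ad_terms br X ts. \<omega> (map \<zeta> Xs @ [Y]))"
proof -
  have \<zeta>V: "\<zeta> Z \<in> vector_fields M" and L: "lie_deriv M (\<zeta> Z) \<omega> = 0" for Z
    using \<zeta> by (auto simp: preserving_fields_def)
  let ?c = "\<lambda>Xs. \<omega> (map \<zeta> Xs @ [Y])" and ?Z = "field_bracket M (\<zeta> X) Y"
  have "apply_field (\<zeta> X) (?c Xs) = coad br X ?c Xs + \<omega> (map \<zeta> Xs @ [?Z])" for Xs
  proof -
    let ?Ys = "map \<zeta> Xs @ [Y]"
    have "set ?Ys \<subseteq> vector_fields M" using \<zeta>V Y by auto
    then have "apply_field (\<zeta> X) (\<omega> ?Ys) = (\<Sum>i<length ?Ys. \<omega> (?Ys[i := field_bracket M (\<zeta> X) (?Ys ! i)]))"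
      using fun_cong[OF L[of X], of ?Ys] by (simp add: lie_deriv_def)
    also have "\<dots> = (\<Sum>i<length Xs. \<omega> (?Ys[i := field_bracket M (\<zeta> X) (?Ys ! i)])) + \<omega> (map \<zeta> Xs @ [?Z])"
      by (simp add: list_update_append nth_append)
    also have "(\<Sum>i<length Xs. \<omega> (?Ys[i := field_bracket M (\<zeta> X) (?Ys ! i)])) = coad br X ?c Xs"
      unfolding coad_def by (intro sum.cong) (simp_all add: map_update hom list_update_append nth_append)
    finally show ?thesis .
  qed
  then have "apply_field (\<zeta> X) (apply_field Y u) =
      (\<Sum>Xs\<leftarrow>ts. coad br X ?c Xs) + (\<Sum>Xs\<leftarrow>ts. \<omega> (map \<zeta> Xs @ [?Z]))"
    unfolding du[OF Y] by (subst apply_field_sum_list[OF \<zeta>V]) (simp_all add: forms_smooth[OF \<omega>] sum_list_addf)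
  moreover have "apply_field ?Z u = (\<Sum>Xs\<leftarrow>ts. \<omega> (map \<zeta> Xs @ [?Z]))"
    by (rule du[OF field_bracket_vector_field[OF \<zeta>V Y]])
  ultimately show ?thesis
    unfolding sum_list_ad_terms using apply_field_bracket[OF u, of "\<zeta> X" Y] by (simp add: algebra_simps)
qed

theorem lemma4p4:
  fixes M :: "('a::{t2_space, second_countable_topology}, 'e::euclidean_space) smooth_structure"
    and n :: nat
    and \<omega> :: "'a form"
    and br :: "'g::real_vector \<Rightarrow> 'g \<Rightarrow> 'g"
    and \<zeta> :: "'g \<Rightarrow> 'a vector_field"
  assumes "n \<ge> 1"
    and "n_plectic_manifold M n \<omega>"
    and "lie_algebra br"
    and "\<exists>B :: 'g set. finite B \<and> span B = UNIV"
    and "n_plectic_action M \<omega> br \<zeta>"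
    and "h_class M n \<omega> br \<zeta> (n + 1) = mixed_class M br (n + 1) 0 0"
    and "h_class M n \<omega> br \<zeta> n = mixed_class M br n 1 0"
  shows "\<exists>v. multi_moment_map M n \<omega> br \<zeta> v"
proof -
  note n = assms(1) and br = assms(3)
  obtain B :: "'g set" where B: "finite B" "span B = UNIV" using assms(4) by blast
  have \<omega>: "\<omega> \<in> forms M (n + 1)" using assms(2) by (simp add: n_plectic_manifold_def)
  have lin_\<zeta>: "linear \<zeta>" and hom: "\<zeta> (br X Y) = field_bracket M (\<zeta> X) (\<zeta> Y)"
    and pres: "range \<zeta> \<subseteq> preserving_fields M \<omega>" for X Y
    using assms(5) by (auto simp: n_plectic_action_def)
  have range_\<zeta>: "range \<zeta> \<subseteq> vector_fields M" and \<zeta>V: "\<zeta> X \<in> vector_fields M" for X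
    using pres by (auto simp: preserving_fields_def)
  let ?P = "lie_kernel br n" and ?ad = "ad_action br n"

  obtain v0 where lin_v0: "linear v0" and "range v0 \<subseteq> smooth_functions M"
    and "\<forall>ts. set ts \<subseteq> tuples n UNIV \<longrightarrow> (\<Sum>Xs\<leftarrow>ts. wedge Xs) \<in> ?P \<longrightarrow>
      (\<Sum>Xs\<leftarrow>ts. contraction_cochain \<omega> \<zeta> n Xs) = ext_deriv M (zero_form (v0 (\<Sum>Xs\<leftarrow>ts. wedge Xs)))"
    using primitive_on_lie_kernel[OF br n, of "contraction_cochain \<omega> \<zeta> n" M]
      h_class_zeroD[OF br B lin_\<zeta> range_\<zeta> \<omega>, of n] assms(7) by auto
  then have sm_v0: "v0 p \<in> smooth_functions M"
    and v0: "set ts \<subseteq> tuples n UNIV \<Longrightarrow> (\<Sum>Xs\<leftarrow>ts. wedge Xs) \<in> ?P \<Longrightarrow>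
      (\<Sum>Xs\<leftarrow>ts. contraction_cochain \<omega> \<zeta> n Xs) = ext_deriv M (zero_form (v0 (\<Sum>Xs\<leftarrow>ts. wedge Xs)))" for p ts
    by auto
  obtain w where lin_w: "linear w" and "range w \<subseteq> smooth_functions M"
    and "\<forall>X ts. set ts \<subseteq> tuples n UNIV \<longrightarrow> (\<Sum>Xs\<leftarrow>ts. wedge Xs) \<in> ?P \<longrightarrow>
      (\<Sum>Xs\<leftarrow>ts. contraction_cochain \<omega> \<zeta> (n + 1) (Xs @ [X]) []) = w (\<Sum>Xs\<leftarrow>ad_terms br X ts. wedge Xs)"
    using potential_on_ad_terms[OF br n, of "contraction_cochain \<omega> \<zeta> (n + 1)" M]
      h_class_zeroD[OF br B lin_\<zeta> range_\<zeta> \<omega>, of "n + 1"] assms(6) by auto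
  then have sm_w: "w p \<in> smooth_functions M"
    and w: "set ts \<subseteq> tuples n UNIV \<Longrightarrow> (\<Sum>Xs\<leftarrow>ts. wedge Xs) \<in> ?P \<Longrightarrow>
      (\<Sum>Xs\<leftarrow>ts. contraction_cochain \<omega> \<zeta> (n + 1) (Xs @ [X]) []) = w (\<Sum>Xs\<leftarrow>ad_terms br X ts. wedge Xs)" for p X ts
    by auto

  have dv0: "apply_field Y (v0 (\<Sum>Xs\<leftarrow>ts. wedge Xs)) = (\<Sum>Xs\<leftarrow>ts. \<omega> (map \<zeta> Xs @ [Y]))"
    if "set ts \<subseteq> tuples n UNIV" "(\<Sum>Xs\<leftarrow>ts. wedge Xs) \<in> ?P" "Y \<in> vector_fields M" for ts Y
  proof -
    have "apply_field Y (v0 (\<Sum>Xs\<leftarrow>ts. wedge Xs)) = (\<Sum>Xs\<leftarrow>ts. contraction_cochain \<omega> \<zeta> n Xs) [Y]"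
      using that by (simp add: v0 ext_deriv_zero_form sm_v0)
    also have "\<dots> = (\<Sum>Xs\<leftarrow>ts. contraction_cochain \<omega> \<zeta> n Xs [Y])"
      by (rule sum_list_apply)
    also have "\<dots> = (\<Sum>Xs\<leftarrow>ts. \<omega> (map \<zeta> Xs @ [Y]))"
      using that(1)
      by (intro arg_cong[where f = sum_list] map_cong)
        (auto simp: contraction_cochain_def contract_tuple_apply tuples_def)
    finally show ?thesis .
  qed
  have terms: "set (wedge_terms n p) \<subseteq> tuples n UNIV" "(\<Sum>Xs\<leftarrow>wedge_terms n p. wedge Xs) = p"
    "?ad X p = (\<Sum>Xs\<leftarrow>ad_terms br X (wedge_terms n p). wedge Xs)" if "p \<in> ?P" for p X
    using that wedge_terms[OF n, of p] ad_action_eq_ad_terms[OF n, of p br X] by (auto simp: lie_kernel_def)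

  have w_ad: "w (?ad X p) = apply_field (\<zeta> X) (v0 p)" if p: "p \<in> ?P" for X p
  proof -
    have "w (?ad X p) = (\<Sum>Xs\<leftarrow>wedge_terms n p. contraction_cochain \<omega> \<zeta> (n + 1) (Xs @ [X]) [])"
      using w[OF terms(1)[OF p], of X] p by (simp add: terms(2,3)[OF p])
    also have "\<dots> = (\<Sum>Xs\<leftarrow>wedge_terms n p. \<omega> (map \<zeta> Xs @ [\<zeta> X]))"
      using terms(1)[OF p]
      by (intro arg_cong[where f = sum_list] map_cong)
        (auto simp: contraction_cochain_def contract_tuple_apply tuples_def)
    also have "\<dots> = apply_field (\<zeta> X) (v0 p)"
      using dv0[OF terms(1)[OF p], of "\<zeta> X"] p \<zeta>V by (simp add: terms(2)[OF p])
    finally show ?thesis .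
  qed
  have dw_ad: "apply_field Y (w (?ad X p)) = apply_field Y (v0 (?ad X p))"
    if p: "p \<in> ?P" and Y: "Y \<in> vector_fields M" for X p Y
  proof -
    have "apply_field Y (w (?ad X p)) = (\<Sum>Xs\<leftarrow>ad_terms br X (wedge_terms n p). \<omega> (map \<zeta> Xs @ [Y]))"
      unfolding w_ad[OF p]
    proof (rule derivative_along_preserving_action[where br = br and ts = "wedge_terms n p",
          OF pres hom \<omega> sm_v0 _ Y])
      show "apply_field Z (v0 p) = (\<Sum>Xs\<leftarrow>wedge_terms n p. \<omega> (map \<zeta> Xs @ [Z]))"
        if "Z \<in> vector_fields M" for Z
        using dv0[OF terms(1)[OF p] _ that] p by (simp add: terms(2)[OF p])
    qed
    also have "\<dots> = apply_field Y (v0 (?ad X p))"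
      using dv0[OF ad_terms_tuples[OF terms(1)[OF p]], of br X Y] ad_action_lie_kernel[OF br n p, of X] Y
      by (simp add: terms(3)[OF p, symmetric])
    finally show ?thesis .
  qed

  \<comment> \<open>On \<open>?Q\<close> equivariance forces the value \<open>w\<close>, and there the correction \<open>w - v0\<close> has differential zero.\<close>
  let ?Q = "span {?ad X p | X p. p \<in> ?P}"
  have dQ: "apply_field Y (w q - v0 q) = 0" if "q \<in> ?Q" and Y: "Y \<in> vector_fields M" for q Y
  proof -
    let ?K = "{q. apply_field Y (w q - v0 q) = 0}"
    have lin: "linear (\<lambda>q. apply_field Y (w q - v0 q))"
    proof (rule linearI)
      fix p q and c :: real
      have sm: "w q - v0 q \<in> smooth_functions M" for q
        by (intro subspace_diff[OF subspace_smooth_functions] sm_w sm_v0)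
      have "w (p + q) - v0 (p + q) = (w p - v0 p) + (w q - v0 q)"
        by (simp add: linear_add[OF lin_w] linear_add[OF lin_v0])
      then show "apply_field Y (w (p + q) - v0 (p + q)) = apply_field Y (w p - v0 p) + apply_field Y (w q - v0 q)"
        by (simp only: apply_field_add[OF Y sm sm])
      have "w (c *\<^sub>R p) - v0 (c *\<^sub>R p) = c *\<^sub>R (w p - v0 p)"
        by (simp add: linear_scale[OF lin_w] linear_scale[OF lin_v0] scaleR_diff_right)
      then show "apply_field Y (w (c *\<^sub>R p) - v0 (c *\<^sub>R p)) = c *\<^sub>R apply_field Y (w p - v0 p)"
        by (simp only: apply_field_scale[OF Y sm])
    qed
    have "apply_field Y (w (?ad X p) - v0 (?ad X p)) = 0" if "p \<in> ?P" for X p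
    proof -
      have "apply_field Y (w (?ad X p)) = apply_field Y (w (?ad X p) - v0 (?ad X p)) + apply_field Y (v0 (?ad X p))"
        using apply_field_add[OF Y, of "w (?ad X p) - v0 (?ad X p)" "v0 (?ad X p)"]
        by (simp add: sm_v0 sm_w subspace_diff[OF subspace_smooth_functions])
      then show ?thesis using dw_ad[OF that Y] by simp
    qed
    then have "?Q \<subseteq> ?K"
      by (intro span_minimal linear_subspace_kernel[OF lin]) auto
    then show ?thesis using that(1) by auto
  qed

  \<comment> \<open>A linear projection onto \<open>?Q\<close>: extend the identity of a basis, with all values in \<open>?Q\<close>. The correction
    is then annihilated by all vector fields wherever it is added.\<close>
  obtain C where "C \<subseteq> {?ad X p | X p. p \<in> ?P}" and C: "independent C"
    and "{?ad X p | X p. p \<in> ?P} \<subseteq> span C"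
    by (rule maximal_independent_subset)
  then have span_C: "span C = ?Q"
    by (intro equalityI span_mono span_minimal subspace_span)
  obtain \<pi> where lin_\<pi>: "linear \<pi>" and \<pi>C: "\<forall>x\<in>C. \<pi> x = x" and range_\<pi>: "range \<pi> = span C"
    using linear_independent_extend_subspace[OF C, of "\<lambda>x. x"] by auto
  have \<pi>_id: "\<pi> q = q" if "q \<in> ?Q" for q
    using linear_eq_on_span[OF lin_\<pi> linear_id, of C q] \<pi>C that span_C by simp
  have \<pi>_Q: "\<pi> q \<in> ?Q" for q
    using range_\<pi> span_C by auto

  define v where "v p = v0 p + (w (\<pi> p) - v0 (\<pi> p))" for p
  have lin_v: "linear v"
    unfolding v_def
    using linear_compose[OF lin_\<pi> lin_w] linear_compose[OF lin_\<pi> lin_v0]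
    by (intro linear_compose_add linear_compose_sub lin_v0) (simp_all add: o_def)
  have sm_v: "v p \<in> smooth_functions M" for p
    unfolding v_def
    by (intro subspace_add[OF subspace_smooth_functions] subspace_diff[OF subspace_smooth_functions] sm_v0 sm_w)
  have dv: "apply_field Y (v p) = apply_field Y (v0 p)" if "Y \<in> vector_fields M" for Y p
    unfolding v_def
    using apply_field_add[OF that sm_v0, of "w (\<pi> p) - v0 (\<pi> p)" p] dQ[OF \<pi>_Q that, of p]
    by (simp add: sm_v0 sm_w subspace_diff[OF subspace_smooth_functions])
  have v_ad: "v (?ad X p) = apply_field (\<zeta> X) (v0 p)" if "p \<in> ?P" for X p
  proof -
    have "?ad X p \<in> ?Q" using that by (intro span_base) blast
    then show ?thesis by (simp add: v_def \<pi>_id w_ad[OF that])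
  qed
  have "ext_deriv M (zero_form (v p)) = contract_multivector n \<zeta> p \<omega>" if p: "p \<in> ?P" for p
  proof -
    have "ext_deriv M (zero_form (v p)) = ext_deriv M (zero_form (v0 p))"
    proof
      fix Xs
      show "ext_deriv M (zero_form (v p)) Xs = ext_deriv M (zero_form (v0 p)) Xs"
        by (cases Xs) (auto simp: ext_deriv_zero_form sm_v sm_v0 dv)
    qed
    also have "\<dots> = (\<Sum>Xs\<leftarrow>wedge_terms n p. contraction_cochain \<omega> \<zeta> n Xs)"
      using v0[OF terms(1)[OF p]] p by (simp add: terms(2)[OF p])
    also have "\<dots> = contract_multivector n \<zeta> p \<omega>"
      unfolding contract_multivector_def using terms(1)[OF p]
      by (intro arg_cong[where f = sum_list] map_cong) (auto simp: contraction_cochain_def tuples_def)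
    finally show ?thesis .
  qed
  moreover have "zero_form (v (?ad X p)) = lie_deriv M (\<zeta> X) (zero_form (v p))" if "p \<in> ?P" for X p
    by (simp add: lie_deriv_zero_form[OF \<zeta>V] dv[OF \<zeta>V] v_ad[OF that])
  ultimately have "multi_moment_map M n \<omega> br \<zeta> v"
    using sm_v by (auto simp: multi_moment_map_def linear_on_def linear_add[OF lin_v] linear_scale[OF lin_v])
  then show ?thesis by blast
qed

end
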